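(* Let $\mathsf C$ and $\mathsf D$ be abelian categories, suppose that $\mathsf C$ has enough projectives, and let $F\colon\mathsf C\to\mathsf D$ be an exact functor. Then $F$ respects and reflects projectivity if and only if $\mathrm{dp}(A)=\mathrm{dp}(F(A))$ for every object $A$ of $\mathsf C$.
   Context: For an object $A$ of an abelian category, the projective dimension is $\mathrm{dp}(A):=\inf\{n\in\mathbb N\mid A\text{ has a projective resolution of length }n\}\in\mathbb N\cup\{\infty\}$, with $0\in\mathbb N$ and $\inf\emptyset=\infty$. A projective resolution of length $n$ is an exact sequence $0\to P_n\to\cdots\to P_0\to A\to 0$ with all $P_i$ projective. $F$ respects projectivity if $F(P)$ is projective for every projective object $P$ of $\mathsf C$; $F$ reflects projectivity if every object $P$ of $\mathsf C$ such that $F(P)$ is projective is itself projective. *)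

theory Defs
  imports Main "HOL-Algebra.Group" "HOL-Library.Extended_Nat"
begin

text \<open>
  Categories are records with explicit sets of objects and arrows;
  \<open>g \<cdot>\<^bsub>C\<^esub> f\<close> is ``first \<open>f\<close>, then \<open>g\<close>'' and is only meaningful when
  \<open>Cod C f = Dom C g\<close>.
\<close>

record ('o, 'm) cat =
  Obj :: "'o set"
  Arr :: "'m set"
  Dom :: "'m \<Rightarrow> 'o"
  Cod :: "'m \<Rightarrow> 'o"
  Id :: "'o \<Rightarrow> 'm"
  Comp :: "'m \<Rightarrow> 'm \<Rightarrow> 'm"  (infixl \<open>\<cdot>\<index>\<close> 70)

definition homset :: "('o, 'm, 'z) cat_scheme \<Rightarrow> 'o \<Rightarrow> 'o \<Rightarrow> 'm set" where
  "homset C A B = {f \<in> Arr C. Dom C f = A \<and> Cod C f = B}"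

locale category =
  fixes C :: "('o, 'm, 'z) cat_scheme"  (structure)
  assumes Dom_closed: "f \<in> Arr C \<Longrightarrow> Dom C f \<in> Obj C"
    and Cod_closed: "f \<in> Arr C \<Longrightarrow> Cod C f \<in> Obj C"
    and Id_closed: "A \<in> Obj C \<Longrightarrow> Id C A \<in> homset C A A"
    and Comp_closed: "\<lbrakk>f \<in> homset C A B; g \<in> homset C B B'\<rbrakk> \<Longrightarrow> g \<cdot> f \<in> homset C A B'"
    and Comp_Id: "f \<in> homset C A B \<Longrightarrow> f \<cdot> Id C A = f"
    and Id_Comp: "f \<in> homset C A B \<Longrightarrow> Id C B \<cdot> f = f"
    and Comp_assoc: "\<lbrakk>f \<in> homset C X Y; g \<in> homset C Y Z; h \<in> homset C Z W\<rbrakk>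
      \<Longrightarrow> (h \<cdot> g) \<cdot> f = h \<cdot> (g \<cdot> f)"

definition is_mono :: "('o, 'm, 'z) cat_scheme \<Rightarrow> 'm \<Rightarrow> bool" where
  "is_mono C f \<longleftrightarrow> f \<in> Arr C \<and>
     (\<forall>X. \<forall>g \<in> homset C X (Dom C f). \<forall>h \<in> homset C X (Dom C f).
        f \<cdot>\<^bsub>C\<^esub> g = f \<cdot>\<^bsub>C\<^esub> h \<longrightarrow> g = h)"

definition is_epi :: "('o, 'm, 'z) cat_scheme \<Rightarrow> 'm \<Rightarrow> bool" where
  "is_epi C f \<longleftrightarrow> f \<in> Arr C \<and>
     (\<forall>X. \<forall>g \<in> homset C (Cod C f) X. \<forall>h \<in> homset C (Cod C f) X.
        g \<cdot>\<^bsub>C\<^esub> f = h \<cdot>\<^bsub>C\<^esub> f \<longrightarrow> g = h)"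

definition zero_object :: "('o, 'm, 'z) cat_scheme \<Rightarrow> 'o \<Rightarrow> bool" where
  "zero_object C Z \<longleftrightarrow> Z \<in> Obj C \<and>
     (\<forall>A \<in> Obj C. (\<exists>!f. f \<in> homset C Z A) \<and> (\<exists>!f. f \<in> homset C A Z))"

definition projective :: "('o, 'm, 'z) cat_scheme \<Rightarrow> 'o \<Rightarrow> bool" where
  "projective C P \<longleftrightarrow> P \<in> Obj C \<and>
     (\<forall>e f. is_epi C e \<and> f \<in> homset C P (Cod C e) \<longrightarrow>
        (\<exists>g \<in> homset C P (Dom C e). e \<cdot>\<^bsub>C\<^esub> g = f))"

definition enough_projectives :: "('o, 'm, 'z) cat_scheme \<Rightarrow> bool" where
  "enough_projectives C \<longleftrightarrow>
     (\<forall>A \<in> Obj C. \<exists>P e. projective C P \<and> e \<in> homset C P A \<and> is_epi C e)"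


text \<open>
  Preadditive structure: \<open>Zer C A B\<close> is the zero morphism from \<open>A\<close> to \<open>B\<close>, and
  \<open>Add\<close> is only meaningful on parallel arrows.
\<close>

record ('o, 'm) preadditive_cat = "('o, 'm) cat" +
  Add :: "'m \<Rightarrow> 'm \<Rightarrow> 'm"  (infixl \<open>\<uplus>\<index>\<close> 65)
  Zer :: "'o \<Rightarrow> 'o \<Rightarrow> 'm"

locale preadditive_category = category C
  for C :: "('o, 'm, 'z) preadditive_cat_scheme"  (structure) +
  assumes hom_group: "\<lbrakk>A \<in> Obj C; B \<in> Obj C\<rbrakk>
      \<Longrightarrow> comm_group \<lparr>carrier = homset C A B, mult = Add C, one = Zer C A B\<rparr>"
    and Comp_Add: "\<lbrakk>f \<in> homset C X Y; f' \<in> homset C X Y; g \<in> homset C Y Z\<rbrakk>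
      \<Longrightarrow> g \<cdot> (f \<uplus> f') = (g \<cdot> f) \<uplus> (g \<cdot> f')"
    and Add_Comp: "\<lbrakk>f \<in> homset C X Y; g \<in> homset C Y Z; g' \<in> homset C Y Z\<rbrakk>
      \<Longrightarrow> (g \<uplus> g') \<cdot> f = (g \<cdot> f) \<uplus> (g' \<cdot> f)"

definition is_kernel :: "('o, 'm, 'z) preadditive_cat_scheme \<Rightarrow> 'm \<Rightarrow> 'm \<Rightarrow> bool" where
  "is_kernel C k f \<longleftrightarrow> k \<in> Arr C \<and> f \<in> Arr C \<and> Cod C k = Dom C f \<and>
     f \<cdot>\<^bsub>C\<^esub> k = Zer C (Dom C k) (Cod C f) \<and>
     (\<forall>X. \<forall>g \<in> homset C X (Dom C f). f \<cdot>\<^bsub>C\<^esub> g = Zer C X (Cod C f) \<longrightarrow>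
        (\<exists>!h. h \<in> homset C X (Dom C k) \<and> k \<cdot>\<^bsub>C\<^esub> h = g))"

definition is_cokernel :: "('o, 'm, 'z) preadditive_cat_scheme \<Rightarrow> 'm \<Rightarrow> 'm \<Rightarrow> bool" where
  "is_cokernel C c f \<longleftrightarrow> c \<in> Arr C \<and> f \<in> Arr C \<and> Dom C c = Cod C f \<and>
     c \<cdot>\<^bsub>C\<^esub> f = Zer C (Dom C f) (Cod C c) \<and>
     (\<forall>X. \<forall>g \<in> homset C (Cod C f) X. g \<cdot>\<^bsub>C\<^esub> f = Zer C (Dom C f) X \<longrightarrow>
        (\<exists>!h. h \<in> homset C (Cod C c) X \<and> h \<cdot>\<^bsub>C\<^esub> c = g))"

definition has_biproduct :: "('o, 'm, 'z) preadditive_cat_scheme \<Rightarrow> 'o \<Rightarrow> 'o \<Rightarrow> bool" where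
  "has_biproduct C A B \<longleftrightarrow>
     (\<exists>S \<in> Obj C. \<exists>i \<in> homset C A S. \<exists>j \<in> homset C B S.
        \<exists>p \<in> homset C S A. \<exists>q \<in> homset C S B.
          p \<cdot>\<^bsub>C\<^esub> i = Id C A \<and> q \<cdot>\<^bsub>C\<^esub> j = Id C B \<and>
          p \<cdot>\<^bsub>C\<^esub> j = Zer C B A \<and> q \<cdot>\<^bsub>C\<^esub> i = Zer C A B \<and>
          (i \<cdot>\<^bsub>C\<^esub> p) \<uplus>\<^bsub>C\<^esub> (j \<cdot>\<^bsub>C\<^esub> q) = Id C S)"

locale abelian_category = preadditive_category C
  for C :: "('o, 'm, 'z) preadditive_cat_scheme"  (structure) +
  assumes ex_zero_object: "\<exists>Z. zero_object C Z"
    and ex_biproduct: "\<lbrakk>A \<in> Obj C; B \<in> Obj C\<rbrakk> \<Longrightarrow> has_biproduct C A B"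
    and ex_kernel: "f \<in> Arr C \<Longrightarrow> \<exists>k. is_kernel C k f"
    and ex_cokernel: "f \<in> Arr C \<Longrightarrow> \<exists>c. is_cokernel C c f"
    and mono_normal: "is_mono C f \<Longrightarrow> \<exists>g. is_kernel C f g"
    and epi_normal: "is_epi C f \<Longrightarrow> \<exists>g. is_cokernel C f g"

definition is_image :: "('o, 'm, 'z) preadditive_cat_scheme \<Rightarrow> 'm \<Rightarrow> 'm \<Rightarrow> bool" where
  "is_image C m f \<longleftrightarrow> (\<exists>c. is_cokernel C c f \<and> is_kernel C m c)"

text \<open>
  Exactness of \<open>\<bullet> \<rightarrow> \<bullet> \<rightarrow> \<bullet>\<close> (first \<open>f\<close>, then \<open>g\<close>) in the middle: a common
  monomorphism represents the image of \<open>f\<close> and the kernel of \<open>g\<close>.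
  This forces \<open>Cod C f = Dom C g\<close>.
\<close>

definition exact_at :: "('o, 'm, 'z) preadditive_cat_scheme \<Rightarrow> 'm \<Rightarrow> 'm \<Rightarrow> bool" where
  "exact_at C f g \<longleftrightarrow> (\<exists>m. is_image C m f \<and> is_kernel C m g)"

definition short_exact :: "('o, 'm, 'z) preadditive_cat_scheme \<Rightarrow> 'm \<Rightarrow> 'm \<Rightarrow> bool" where
  "short_exact C f g \<longleftrightarrow>
     (\<exists>Z Z'. zero_object C Z \<and> zero_object C Z' \<and>
        exact_at C (Zer C Z (Dom C f)) f \<and> exact_at C f g \<and>
        exact_at C g (Zer C (Cod C g) Z'))"

text \<open>
  The exact sequence \<open>0 \<rightarrow> P\<^sub>n \<rightarrow> \<dots> \<rightarrow> P\<^sub>0 \<rightarrow> A \<rightarrow> 0\<close> is indexed from the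
  right: \<open>X 0 = 0\<close>, \<open>X 1 = A\<close>, \<open>X (i + 2) = P\<^sub>i\<close> for \<open>i \<le> n\<close>, \<open>X (n + 3) = 0\<close>.
\<close>

definition projective_resolution ::
  "('o, 'm, 'z) preadditive_cat_scheme \<Rightarrow> 'o \<Rightarrow> nat \<Rightarrow> (nat \<Rightarrow> 'o) \<Rightarrow> (nat \<Rightarrow> 'm) \<Rightarrow> bool" where
  "projective_resolution C A n X d \<longleftrightarrow>
     zero_object C (X 0) \<and> X 1 = A \<and> zero_object C (X (n + 3)) \<and>
     (\<forall>i \<le> n. projective C (X (i + 2))) \<and>
     (\<forall>i < n + 3. d i \<in> homset C (X (i + 1)) (X i)) \<and>
     (\<forall>i < n + 2. exact_at C (d (i + 1)) (d i))"

definition dp :: "('o, 'm, 'z) preadditive_cat_scheme \<Rightarrow> 'o \<Rightarrow> enat" where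
  "dp C A = Inf (enat ` {n. \<exists>X d. projective_resolution C A n X d})"


record ('o, 'm, 'p, 'n) funct =
  OMap :: "'o \<Rightarrow> 'p"
  AMap :: "'m \<Rightarrow> 'n"

locale is_functor = C: category C + D: category D
  for C :: "('o, 'm, 'y) cat_scheme" and D :: "('p, 'n, 'z) cat_scheme"
    and F :: "('o, 'm, 'p, 'n) funct" +
  assumes OMap_closed: "A \<in> Obj C \<Longrightarrow> OMap F A \<in> Obj D"
    and AMap_closed: "f \<in> homset C A B \<Longrightarrow> AMap F f \<in> homset D (OMap F A) (OMap F B)"
    and AMap_Id: "A \<in> Obj C \<Longrightarrow> AMap F (Id C A) = Id D (OMap F A)"
    and AMap_Comp: "\<lbrakk>f \<in> homset C X Y; g \<in> homset C Y Z\<rbrakk>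
      \<Longrightarrow> AMap F (g \<cdot>\<^bsub>C\<^esub> f) = AMap F g \<cdot>\<^bsub>D\<^esub> AMap F f"

locale exact_functor = is_functor C D F
  for C :: "('o, 'm, 'y) preadditive_cat_scheme"
    and D :: "('p, 'n, 'z) preadditive_cat_scheme"
    and F :: "('o, 'm, 'p, 'n) funct" +
  assumes AMap_Add: "\<lbrakk>f \<in> homset C A B; g \<in> homset C A B\<rbrakk>
      \<Longrightarrow> AMap F (f \<uplus>\<^bsub>C\<^esub> g) = AMap F f \<uplus>\<^bsub>D\<^esub> AMap F g"
    and AMap_short_exact: "short_exact C f g \<Longrightarrow> short_exact D (AMap F f) (AMap F g)"

definition respects_projectivity ::
  "('o, 'm, 'y) cat_scheme \<Rightarrow> ('p, 'n, 'z) cat_scheme \<Rightarrow> ('o, 'm, 'p, 'n) funct \<Rightarrow> bool" where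
  "respects_projectivity C D F \<longleftrightarrow>
     (\<forall>P \<in> Obj C. projective C P \<longrightarrow> projective D (OMap F P))"

definition reflects_projectivity ::
  "('o, 'm, 'y) cat_scheme \<Rightarrow> ('p, 'n, 'z) cat_scheme \<Rightarrow> ('o, 'm, 'p, 'n) funct \<Rightarrow> bool" where
  "reflects_projectivity C D F \<longleftrightarrow>
     (\<forall>P \<in> Obj C. projective D (OMap F P) \<longrightarrow> projective C P)"

end

theory Submission
  imports Defs
begin

text \<open>
  The proof replaces long resolutions by iterated short exact sequences.  An object \<open>A\<close> has a
  projective resolution of length \<open>n + 1\<close> exactly when there is a short exact sequence
  \<open>0 \<rightarrow> K \<rightarrow> P \<rightarrow> A \<rightarrow> 0\<close> with \<open>P\<close> projective and \<open>K\<close> having one of length \<open>n\<close>; length \<open>0\<close>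
  means that \<open>A\<close> itself is projective.  The recursive predicate \<open>pdim_le\<close> records this, and
  \<open>resolution_iff_pdim_le\<close> proves the equivalence by splicing and truncating resolutions at the
  first syzygy.  In particular \<open>dp A = 0\<close> says that \<open>A\<close> is projective, so a functor preserving
  \<open>dp\<close> respects and reflects projectivity.

  For the converse it suffices that \<open>A\<close> and \<open>F A\<close> admit resolutions of the same lengths.  An exact
  \<open>F\<close> that respects projectivity maps the short exact sequences for \<open>A\<close> to such sequences for
  \<open>F A\<close>.  In the other direction, let \<open>F A\<close> have a resolution of length \<open>n + 1\<close> and choose
  \<open>0 \<rightarrow> K \<rightarrow> P \<rightarrow> A \<rightarrow> 0\<close> with \<open>P\<close> projective.  Then \<open>0 \<rightarrow> F K \<rightarrow> F P \<rightarrow> F A \<rightarrow> 0\<close> is one projective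
  presentation of \<open>F A\<close>, and the given resolution starts with a possibly different one.  Schanuel's
  argument (\<open>pdim_le_syzygy\<close>) shows that the choice of presentation does not matter, so \<open>F K\<close> has
  a resolution of length \<open>n\<close>; by induction so does \<open>K\<close>.  The induction ends with \<open>F\<close> of a syzygy
  being projective, where reflection of projectivity applies.

  Schanuel's argument rests on the fact that for \<open>0 \<rightarrow> L \<rightarrow> M \<rightarrow> Q \<rightarrow> 0\<close> with \<open>Q\<close> projective,
  \<open>L\<close> and \<open>M\<close> admit resolutions of the same lengths (\<open>pdim_le_of_ses_left\<close>,
  \<open>pdim_le_of_ses_middle\<close>).  Each direction modifies only the first projective of a resolution and
  keeps its first syzygy.
\<close>

section \<open>Calculus in preadditive categories\<close>

context preadditive_category
begin

lemma hom_Obj: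
  assumes "f \<in> homset C A B"
  shows "A \<in> Obj C" "B \<in> Obj C"
  using assms Dom_closed Cod_closed by (auto simp: homset_def)

lemma hom_Arr: "f \<in> homset C A B \<Longrightarrow> f \<in> Arr C"
  and hom_Dom: "f \<in> homset C A B \<Longrightarrow> Dom C f = A"
  and hom_Cod: "f \<in> homset C A B \<Longrightarrow> Cod C f = B"
  by (auto simp: homset_def)

lemma Add_closed:
  assumes "f \<in> homset C A B" "g \<in> homset C A B"
  shows "f \<uplus> g \<in> homset C A B"
proof -
  interpret G: comm_group "\<lparr>carrier = homset C A B, mult = Add C, one = Zer C A B\<rparr>"
    using hom_group hom_Obj[OF assms(1)] by blast
  show ?thesis using G.m_closed assms by simp
qed

lemma Zer_closed:
  assumes "A \<in> Obj C" "B \<in> Obj C"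
  shows "Zer C A B \<in> homset C A B"
proof -
  interpret G: comm_group "\<lparr>carrier = homset C A B, mult = Add C, one = Zer C A B\<rparr>"
    using hom_group assms by blast
  show ?thesis using G.one_closed by simp
qed

lemma Add_Zer:
  assumes "f \<in> homset C A B"
  shows "f \<uplus> Zer C A B = f" "Zer C A B \<uplus> f = f"
proof -
  interpret G: comm_group "\<lparr>carrier = homset C A B, mult = Add C, one = Zer C A B\<rparr>"
    using hom_group hom_Obj[OF assms(1)] by blast
  show "f \<uplus> Zer C A B = f" "Zer C A B \<uplus> f = f" using G.r_one G.l_one assms by simp_all
qed

lemma Add_commute:
  assumes "f \<in> homset C A B" "g \<in> homset C A B"
  shows "f \<uplus> g = g \<uplus> f"
proof -
  interpret G: comm_group "\<lparr>carrier = homset C A B, mult = Add C, one = Zer C A B\<rparr>"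
    using hom_group hom_Obj[OF assms(1)] by blast
  show ?thesis using G.m_comm assms by simp
qed

lemma Add_assoc:
  assumes "f \<in> homset C A B" "g \<in> homset C A B" "h \<in> homset C A B"
  shows "(f \<uplus> g) \<uplus> h = f \<uplus> (g \<uplus> h)"
proof -
  interpret G: comm_group "\<lparr>carrier = homset C A B, mult = Add C, one = Zer C A B\<rparr>"
    using hom_group hom_Obj[OF assms(1)] by blast
  show ?thesis using G.m_assoc assms by simp
qed

lemma Add_left_cancel:
  assumes "f \<in> homset C A B" "g \<in> homset C A B" "h \<in> homset C A B" "f \<uplus> g = f \<uplus> h"
  shows "g = h"
proof -
  interpret G: comm_group "\<lparr>carrier = homset C A B, mult = Add C, one = Zer C A B\<rparr>"
    using hom_group hom_Obj[OF assms(1)] by blast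
  show ?thesis using G.Units_l_cancel[of f g h] G.Units_eq assms by simp
qed

lemma ex_neg:
  assumes "f \<in> homset C A B"
  obtains g where "g \<in> homset C A B" "f \<uplus> g = Zer C A B" "g \<uplus> f = Zer C A B"
proof -
  interpret G: comm_group "\<lparr>carrier = homset C A B, mult = Add C, one = Zer C A B\<rparr>"
    using hom_group hom_Obj[OF assms(1)] by blast
  show ?thesis using that G.r_inv_ex[of f] G.l_inv_ex assms Add_commute by auto
qed

lemma Comp_Zer:
  assumes "g \<in> homset C Y Z" "X \<in> Obj C"
  shows "g \<cdot> Zer C X Y = Zer C X Z"
proof -
  have z: "Zer C X Y \<in> homset C X Y" using assms hom_Obj Zer_closed by blast
  have c: "g \<cdot> Zer C X Y \<in> homset C X Z" using z assms Comp_closed by blast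
  have "(g \<cdot> Zer C X Y) \<uplus> (g \<cdot> Zer C X Y) = (g \<cdot> Zer C X Y) \<uplus> Zer C X Z"
    using Comp_Add[OF z z assms(1)] Add_Zer[OF z] Add_Zer[OF c] by simp
  then show ?thesis
    using Add_left_cancel[OF c c] Zer_closed hom_Obj[OF c] by blast
qed

lemma Zer_Comp:
  assumes "f \<in> homset C X Y" "Z \<in> Obj C"
  shows "Zer C Y Z \<cdot> f = Zer C X Z"
proof -
  have z: "Zer C Y Z \<in> homset C Y Z" using assms hom_Obj Zer_closed by blast
  have c: "Zer C Y Z \<cdot> f \<in> homset C X Z" using z assms Comp_closed by blast
  have "(Zer C Y Z \<cdot> f) \<uplus> (Zer C Y Z \<cdot> f) = (Zer C Y Z \<cdot> f) \<uplus> Zer C X Z"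
    using Add_Comp[OF assms(1) z z] Add_Zer[OF z] Add_Zer[OF c] by simp
  then show ?thesis
    using Add_left_cancel[OF c c] Zer_closed hom_Obj[OF c] by blast
qed

lemma mono_cancel:
  assumes "is_mono C f" "f \<in> homset C A B" "g \<in> homset C X A" "h \<in> homset C X A" "f \<cdot> g = f \<cdot> h"
  shows "g = h"
  using assms by (auto simp: is_mono_def hom_Dom)

lemma epi_cancel:
  assumes "is_epi C f" "f \<in> homset C A B" "g \<in> homset C B X" "h \<in> homset C B X" "g \<cdot> f = h \<cdot> f"
  shows "g = h"
  using assms by (auto simp: is_epi_def hom_Cod)

lemma mono_cancel_Zer:
  assumes "is_mono C f" "f \<in> homset C A B" "g \<in> homset C X A" "f \<cdot> g = Zer C X B"
  shows "g = Zer C X A"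
proof (rule mono_cancel[OF assms(1-3)])
  show "Zer C X A \<in> homset C X A" using hom_Obj[OF assms(3)] Zer_closed by blast
  show "f \<cdot> g = f \<cdot> Zer C X A" using assms hom_Obj[OF assms(3)] Comp_Zer by simp
qed

lemma epi_cancel_Zer:
  assumes "is_epi C f" "f \<in> homset C A B" "g \<in> homset C B X" "g \<cdot> f = Zer C A X"
  shows "g = Zer C B X"
proof (rule epi_cancel[OF assms(1-3)])
  show "Zer C B X \<in> homset C B X" using hom_Obj[OF assms(3)] Zer_closed by blast
  show "g \<cdot> f = Zer C B X \<cdot> f" using assms hom_Obj[OF assms(3)] Zer_Comp by simp
qed

lemma monoI:
  assumes f: "f \<in> homset C A B"
    and 0: "\<And>X g. \<lbrakk>g \<in> homset C X A; f \<cdot> g = Zer C X B\<rbrakk> \<Longrightarrow> g = Zer C X A"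
  shows "is_mono C f"
  unfolding is_mono_def hom_Dom[OF f]
proof (intro conjI allI ballI impI)
  show "f \<in> Arr C" using f hom_Arr by blast
next
  fix X g h
  assume g: "g \<in> homset C X A" and h: "h \<in> homset C X A" and eq: "f \<cdot> g = f \<cdot> h"
  obtain n where n: "n \<in> homset C X A" "h \<uplus> n = Zer C X A" "n \<uplus> h = Zer C X A"
    using ex_neg[OF h] .
  have "f \<cdot> (g \<uplus> n) = f \<cdot> (h \<uplus> n)"
    using Comp_Add[OF g n(1) f] Comp_Add[OF h n(1) f] eq by simp
  also have "\<dots> = Zer C X B" using n Comp_Zer[OF f] hom_Obj[OF g] by simp
  finally have "g \<uplus> n = Zer C X A" using 0 Add_closed g n by blast
  then have "n \<uplus> g = n \<uplus> h" using n Add_commute[OF g n(1)] by simp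
  then show "g = h" using Add_left_cancel n g h by blast
qed

lemma epiI:
  assumes f: "f \<in> homset C A B"
    and 0: "\<And>X g. \<lbrakk>g \<in> homset C B X; g \<cdot> f = Zer C A X\<rbrakk> \<Longrightarrow> g = Zer C B X"
  shows "is_epi C f"
  unfolding is_epi_def hom_Cod[OF f]
proof (intro conjI allI ballI impI)
  show "f \<in> Arr C" using f hom_Arr by blast
next
  fix X g h
  assume g: "g \<in> homset C B X" and h: "h \<in> homset C B X" and eq: "g \<cdot> f = h \<cdot> f"
  obtain n where n: "n \<in> homset C B X" "h \<uplus> n = Zer C B X" "n \<uplus> h = Zer C B X"
    using ex_neg[OF h] .
  have "(g \<uplus> n) \<cdot> f = (h \<uplus> n) \<cdot> f"
    using Add_Comp[OF f g n(1)] Add_Comp[OF f h n(1)] eq by simp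
  also have "\<dots> = Zer C A X" using n Zer_Comp[OF f] hom_Obj[OF g] by simp
  finally have "g \<uplus> n = Zer C B X" using 0 Add_closed g n by blast
  then have "n \<uplus> g = n \<uplus> h" using n Add_commute[OF g n(1)] by simp
  then show "g = h" using Add_left_cancel n g h by blast
qed

lemma mono_Comp_left:
  assumes f: "f \<in> homset C A B" and g: "g \<in> homset C B X" and m: "is_mono C (g \<cdot> f)"
  shows "is_mono C f"
proof (rule monoI[OF f])
  fix W h assume h: "h \<in> homset C W A" and 0: "f \<cdot> h = Zer C W B"
  have "(g \<cdot> f) \<cdot> h = Zer C W X"
    using Comp_assoc[OF h f g] 0 Comp_Zer[OF g] hom_Obj[OF h] by simp
  then show "h = Zer C W A" using mono_cancel_Zer[OF m Comp_closed[OF f g] h] by blast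
qed

lemma mono_Comp:
  assumes f: "f \<in> homset C A B" and g: "g \<in> homset C B X" and m: "is_mono C f" "is_mono C g"
  shows "is_mono C (g \<cdot> f)"
proof (rule monoI[OF Comp_closed[OF f g]])
  fix W h assume h: "h \<in> homset C W A" and 0: "(g \<cdot> f) \<cdot> h = Zer C W X"
  have "g \<cdot> (f \<cdot> h) = Zer C W X" using Comp_assoc[OF h f g] 0 by simp
  then have "f \<cdot> h = Zer C W B" using mono_cancel_Zer[OF m(2) g] Comp_closed[OF h f] by blast
  then show "h = Zer C W A" using mono_cancel_Zer[OF m(1) f h] by blast
qed

lemma kernel_hom:
  assumes "is_kernel C k f" "f \<in> homset C A B"
  shows "k \<in> homset C (Dom C k) A"
  using assms by (auto simp: is_kernel_def homset_def)

lemma kernel_Comp: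
  assumes "is_kernel C k f" "k \<in> homset C K A" "f \<in> homset C A B"
  shows "f \<cdot> k = Zer C K B"
  using assms by (auto simp: is_kernel_def homset_def)

lemma kernel_factor:
  assumes "is_kernel C k f" "k \<in> homset C K A" "f \<in> homset C A B"
    and "g \<in> homset C X A" "f \<cdot> g = Zer C X B"
  obtains h where "h \<in> homset C X K" "k \<cdot> h = g"
proof -
  have "\<exists>h. h \<in> homset C X K \<and> k \<cdot> h = g"
    using assms unfolding is_kernel_def hom_Dom[OF assms(3)] hom_Cod[OF assms(3)]
      hom_Dom[OF assms(2)] by blast
  then show ?thesis using that by blast
qed

lemma kernel_mono:
  assumes k: "is_kernel C k f"
  shows "is_mono C k"
proof -
  have f: "f \<in> homset C (Dom C f) (Cod C f)" using k by (auto simp: is_kernel_def homset_def)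
  note kh = kernel_hom[OF k f]
  show ?thesis
  proof (rule monoI[OF kh])
    fix X g assume g: "g \<in> homset C X (Dom C k)" and 0: "k \<cdot> g = Zer C X (Dom C f)"
    have z: "Zer C X (Dom C f) \<in> homset C X (Dom C f)"
      using hom_Obj[OF g] hom_Obj[OF f] Zer_closed by blast
    have "f \<cdot> Zer C X (Dom C f) = Zer C X (Cod C f)"
      using Comp_Zer[OF f] hom_Obj[OF g] by blast
    then have "\<exists>!h. h \<in> homset C X (Dom C k) \<and> k \<cdot> h = Zer C X (Dom C f)"
      using k z by (auto simp: is_kernel_def)
    moreover have "Zer C X (Dom C k) \<in> homset C X (Dom C k)"
      using hom_Obj[OF g] Zer_closed by blast
    moreover have "k \<cdot> Zer C X (Dom C k) = Zer C X (Dom C f)"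
      using Comp_Zer[OF kh] hom_Obj[OF g] by blast
    ultimately show "g = Zer C X (Dom C k)" using g 0 by blast
  qed
qed

lemma kernelI:
  assumes k: "k \<in> homset C K A" and f: "f \<in> homset C A B"
    and 0: "f \<cdot> k = Zer C K B" and m: "is_mono C k"
    and fac: "\<And>X g. \<lbrakk>g \<in> homset C X A; f \<cdot> g = Zer C X B\<rbrakk> \<Longrightarrow> \<exists>h \<in> homset C X K. k \<cdot> h = g"
  shows "is_kernel C k f"
  unfolding is_kernel_def hom_Dom[OF f] hom_Dom[OF k] hom_Cod[OF f] hom_Cod[OF k]
proof (intro conjI allI ballI impI)
  fix X g assume "g \<in> homset C X A" "f \<cdot> g = Zer C X B"
  then obtain h where h: "h \<in> homset C X K" "k \<cdot> h = g" using fac by blast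
  then show "\<exists>!h. h \<in> homset C X K \<and> k \<cdot> h = g"
    using mono_cancel[OF m k] by (intro ex1I[of _ h]) auto
qed (use 0 hom_Arr[OF k] hom_Arr[OF f] in auto)

lemma cokernel_hom:
  assumes "is_cokernel C c f" "f \<in> homset C A B"
  shows "c \<in> homset C B (Cod C c)"
  using assms by (auto simp: is_cokernel_def homset_def)

lemma cokernel_Comp:
  assumes "is_cokernel C c f" "f \<in> homset C A B" "c \<in> homset C B K"
  shows "c \<cdot> f = Zer C A K"
  using assms by (auto simp: is_cokernel_def homset_def)

lemma cokernel_factor:
  assumes "is_cokernel C c f" "f \<in> homset C A B" "c \<in> homset C B K"
    and "g \<in> homset C B X" "g \<cdot> f = Zer C A X"
  obtains h where "h \<in> homset C K X" "h \<cdot> c = g"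
proof -
  have "\<exists>h. h \<in> homset C K X \<and> h \<cdot> c = g"
    using assms unfolding is_cokernel_def hom_Dom[OF assms(2)] hom_Cod[OF assms(2)]
      hom_Cod[OF assms(3)] by blast
  then show ?thesis using that by blast
qed

lemma cokernelI:
  assumes f: "f \<in> homset C A B" and c: "c \<in> homset C B K"
    and 0: "c \<cdot> f = Zer C A K" and e: "is_epi C c"
    and fac: "\<And>X g. \<lbrakk>g \<in> homset C B X; g \<cdot> f = Zer C A X\<rbrakk> \<Longrightarrow> \<exists>h \<in> homset C K X. h \<cdot> c = g"
  shows "is_cokernel C c f"
  unfolding is_cokernel_def hom_Dom[OF f] hom_Dom[OF c] hom_Cod[OF f] hom_Cod[OF c]
proof (intro conjI allI ballI impI)
  fix X g assume "g \<in> homset C B X" "g \<cdot> f = Zer C A X"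
  then obtain h where h: "h \<in> homset C K X" "h \<cdot> c = g" using fac by blast
  then show "\<exists>!h. h \<in> homset C K X \<and> h \<cdot> c = g"
    using epi_cancel[OF e c] by (intro ex1I[of _ h]) auto
qed (use 0 hom_Arr[OF c] hom_Arr[OF f] in auto)

text \<open>
  Exactness depends on the second map only through its kernel, so a resolution may be cut or joined
  at a factorisation of a differential through a monomorphism.
\<close>
lemma kernel_cong_mono:
  assumes f: "f \<in> homset C A B" and m: "m \<in> homset C B X" "is_mono C m"
  shows "is_kernel C k (m \<cdot> f) \<longleftrightarrow> is_kernel C k f"
proof -
  have mf: "m \<cdot> f \<in> homset C A X" using f m Comp_closed by blast
  have eq: "(m \<cdot> f) \<cdot> g = Zer C W X \<longleftrightarrow> f \<cdot> g = Zer C W B" if g: "g \<in> homset C W A" for W g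
  proof
    assume "(m \<cdot> f) \<cdot> g = Zer C W X"
    then have "m \<cdot> (f \<cdot> g) = Zer C W X" using Comp_assoc[OF g f m(1)] by simp
    then show "f \<cdot> g = Zer C W B" using mono_cancel_Zer[OF m(2,1) Comp_closed[OF g f]] by blast
  next
    assume "f \<cdot> g = Zer C W B"
    then show "(m \<cdot> f) \<cdot> g = Zer C W X"
      using Comp_assoc[OF g f m(1)] Comp_Zer[OF m(1)] hom_Obj[OF g] by simp
  qed
  show ?thesis
  proof
    assume k: "is_kernel C k (m \<cdot> f)"
    note kh = kernel_hom[OF k mf]
    show "is_kernel C k f"
    proof (rule kernelI[OF kh f _ kernel_mono[OF k]])
      show "f \<cdot> k = Zer C (Dom C k) B" using kernel_Comp[OF k kh mf] eq[OF kh] by blast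
      fix W g assume "g \<in> homset C W A" "f \<cdot> g = Zer C W B"
      then show "\<exists>h \<in> homset C W (Dom C k). k \<cdot> h = g"
        using kernel_factor[OF k kh mf] eq by metis
    qed
  next
    assume k: "is_kernel C k f"
    note kh = kernel_hom[OF k f]
    show "is_kernel C k (m \<cdot> f)"
    proof (rule kernelI[OF kh mf _ kernel_mono[OF k]])
      show "(m \<cdot> f) \<cdot> k = Zer C (Dom C k) X" using kernel_Comp[OF k kh f] eq[OF kh] by blast
      fix W g assume "g \<in> homset C W A" "(m \<cdot> f) \<cdot> g = Zer C W X"
      then show "\<exists>h \<in> homset C W (Dom C k). k \<cdot> h = g"
        using kernel_factor[OF k kh f] eq by metis
    qed
  qed
qed

lemma zero_object_Obj: "zero_object C Z \<Longrightarrow> Z \<in> Obj C"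
  by (simp add: zero_object_def)

lemma hom_from_zero:
  assumes "zero_object C Z" "f \<in> homset C Z A" shows "f = Zer C Z A"
  using assms hom_Obj[OF assms(2)] Zer_closed unfolding zero_object_def by blast

lemma hom_to_zero:
  assumes "zero_object C Z" "f \<in> homset C A Z" shows "f = Zer C A Z"
  using assms hom_Obj[OF assms(2)] Zer_closed unfolding zero_object_def by blast

lemma Id_mono: "A \<in> Obj C \<Longrightarrow> is_mono C (Id C A)"
  by (rule monoI[OF Id_closed]) (auto simp: Id_Comp)

lemma Id_epi: "A \<in> Obj C \<Longrightarrow> is_epi C (Id C A)"
  by (rule epiI[OF Id_closed]) (auto simp: Comp_Id)

lemma zero_mono_kernel:
  assumes Z: "zero_object C Z" and f: "f \<in> homset C A B" and m: "is_mono C f"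
  shows "is_kernel C (Zer C Z A) f"
proof (rule kernelI[OF _ f])
  have o: "A \<in> Obj C" "B \<in> Obj C" "Z \<in> Obj C" using f hom_Obj Z zero_object_Obj by blast+
  show z: "Zer C Z A \<in> homset C Z A" using o Zer_closed by blast
  show "f \<cdot> Zer C Z A = Zer C Z B" using Comp_Zer[OF f] o by blast
  show "is_mono C (Zer C Z A)"
    by (rule monoI[OF z]) (use Z hom_to_zero in blast)
  fix X g assume g: "g \<in> homset C X A" and 0: "f \<cdot> g = Zer C X B"
  have "X \<in> Obj C" using hom_Obj[OF g] by blast
  then have "Zer C X Z \<in> homset C X Z" "Zer C Z A \<cdot> Zer C X Z = g"
    using o Zer_closed Comp_Zer[OF z] mono_cancel_Zer[OF m f g 0] by auto
  then show "\<exists>h \<in> homset C X Z. Zer C Z A \<cdot> h = g" by blast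
qed

lemma Id_kernel_zero:
  assumes Z: "zero_object C Z" and A: "A \<in> Obj C"
  shows "is_kernel C (Id C A) (Zer C A Z)"
proof (rule kernelI[OF Id_closed[OF A]])
  show z: "Zer C A Z \<in> homset C A Z" using Z A Zer_closed zero_object_Obj by blast
  show "Zer C A Z \<cdot> Id C A = Zer C A Z" using Comp_Id[OF z] .
  show "is_mono C (Id C A)" using Id_mono[OF A] .
  fix X g assume "g \<in> homset C X A"
  then show "\<exists>h \<in> homset C X A. Id C A \<cdot> h = g" using Id_Comp by blast
qed

end

section \<open>Exactness in abelian categories\<close>

text \<open>
  Short exactness without zero objects and images: easier to construct and to exploit than
  \<open>short_exact\<close>, with which it agrees by \<open>short_exact_iff_ses\<close>.
\<close>
definition ses :: "('o, 'm, 'z) preadditive_cat_scheme \<Rightarrow> 'm \<Rightarrow> 'm \<Rightarrow> bool" where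
  "ses C k e \<longleftrightarrow> is_kernel C k e \<and> is_epi C e"

context abelian_category
begin

text \<open>
  A monomorphism is the kernel of some \<open>f\<close>.  That \<open>f\<close> factors through the cokernel \<open>c\<close>, so every
  map killed by \<open>c\<close> is killed by \<open>f\<close>.
\<close>
lemma kernel_of_cokernel:
  assumes m: "is_mono C m" and mh: "m \<in> homset C A B"
    and c: "is_cokernel C c m" and ch: "c \<in> homset C B K"
  shows "is_kernel C m c"
proof (rule kernelI[OF mh ch _ m])
  show "c \<cdot> m = Zer C A K" using cokernel_Comp[OF c mh ch] .
  fix X g assume g: "g \<in> homset C X B" and 0: "c \<cdot> g = Zer C X K"
  obtain f where f: "is_kernel C m f" using mono_normal[OF m] by blast
  have fh: "f \<in> homset C B (Cod C f)" using f mh by (auto simp: is_kernel_def homset_def)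
  obtain t where t: "t \<in> homset C K (Cod C f)" "t \<cdot> c = f"
    using cokernel_factor[OF c mh ch fh kernel_Comp[OF f mh fh]] .
  have "f \<cdot> g = Zer C X (Cod C f)"
    using Comp_assoc[OF g ch t(1)] t 0 Comp_Zer[OF t(1)] hom_Obj[OF g] by simp
  then show "\<exists>h \<in> homset C X A. m \<cdot> h = g"
    using kernel_factor[OF f mh fh g] by blast
qed

lemma cokernel_of_kernel:
  assumes e: "is_epi C e" and eh: "e \<in> homset C A B"
    and k: "is_kernel C k e" and kh: "k \<in> homset C K A"
  shows "is_cokernel C e k"
proof (rule cokernelI[OF kh eh _ e])
  show "e \<cdot> k = Zer C K B" using kernel_Comp[OF k kh eh] .
  fix X g assume g: "g \<in> homset C A X" and 0: "g \<cdot> k = Zer C K X"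
  obtain f where f: "is_cokernel C e f" using epi_normal[OF e] by blast
  have fh: "f \<in> homset C (Dom C f) A" using f eh by (auto simp: is_cokernel_def homset_def)
  obtain t where t: "t \<in> homset C (Dom C f) K" "k \<cdot> t = f"
    using kernel_factor[OF k kh eh fh cokernel_Comp[OF f fh eh]] .
  have "g \<cdot> f = Zer C (Dom C f) X"
    using Comp_assoc[OF t(1) kh g] t 0 Zer_Comp[OF t(1)] hom_Obj[OF g] by simp
  then show "\<exists>h \<in> homset C B X. h \<cdot> e = g"
    using cokernel_factor[OF f fh eh g] by blast
qed

text \<open>
  Together with \<open>exact_atE\<close> this characterises exactness of \<open>f\<close>, \<open>g\<close>: the corestriction of \<open>f\<close> to the
  kernel of \<open>g\<close> is epi.  Here \<open>k \<cdot> e\<close> and \<open>k\<close> have the same cokernel because \<open>e\<close> is epi, and the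
  monomorphism \<open>k\<close> is the kernel of that cokernel.
\<close>
lemma exact_atI:
  assumes k: "is_kernel C k g" and kh: "k \<in> homset C K B"
    and e: "is_epi C e" and eh: "e \<in> homset C A K"
  shows "exact_at C (k \<cdot> e) g"
proof -
  have ke: "k \<cdot> e \<in> homset C A B" using Comp_closed eh kh by blast
  obtain c where c: "is_cokernel C c (k \<cdot> e)" using ex_cokernel hom_Arr[OF ke] by blast
  note ch = cokernel_hom[OF c ke]
  let ?Q = "Cod C c"
  have cepi: "is_epi C c"
  proof (rule epiI[OF ch])
    fix X h assume h: "h \<in> homset C ?Q X" and 0: "h \<cdot> c = Zer C B X"
    have o: "X \<in> Obj C" "?Q \<in> Obj C" "B \<in> Obj C" using hom_Obj h ch by blast+
    have "Zer C B X \<cdot> (k \<cdot> e) = Zer C A X" using Zer_Comp[OF ke] o by blast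
    then have "\<exists>!h. h \<in> homset C ?Q X \<and> h \<cdot> c = Zer C B X"
      using c Zer_closed o unfolding is_cokernel_def hom_Dom[OF ke] hom_Cod[OF ke] by blast
    moreover have "Zer C ?Q X \<in> homset C ?Q X" "Zer C ?Q X \<cdot> c = Zer C B X"
      using o Zer_closed Zer_Comp[OF ch] by blast+
    ultimately show "h = Zer C ?Q X" using h 0 by blast
  qed
  have eq: "t \<cdot> (k \<cdot> e) = Zer C A X \<longleftrightarrow> t \<cdot> k = Zer C K X" if t: "t \<in> homset C B X" for t X
  proof
    assume "t \<cdot> (k \<cdot> e) = Zer C A X"
    then have "(t \<cdot> k) \<cdot> e = Zer C A X" using Comp_assoc[OF eh kh t] by simp
    then show "t \<cdot> k = Zer C K X" using epi_cancel_Zer[OF e eh Comp_closed[OF kh t]] by blast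
  next
    assume "t \<cdot> k = Zer C K X"
    then show "t \<cdot> (k \<cdot> e) = Zer C A X"
      using Comp_assoc[OF eh kh t, symmetric] Zer_Comp[OF eh] hom_Obj[OF t] by simp
  qed
  have "is_cokernel C c k"
  proof (rule cokernelI[OF kh ch _ cepi])
    show "c \<cdot> k = Zer C K ?Q" using eq[OF ch] cokernel_Comp[OF c ke ch] by blast
    fix X t assume t: "t \<in> homset C B X" and "t \<cdot> k = Zer C K X"
    then have "t \<cdot> (k \<cdot> e) = Zer C A X" using eq by blast
    then show "\<exists>h \<in> homset C ?Q X. h \<cdot> c = t" using cokernel_factor[OF c ke ch t] by blast
  qed
  then have "is_kernel C k c"
    using kernel_of_cokernel[OF kernel_mono[OF k] kh _ ch] by blast
  then show ?thesis using c k unfolding exact_at_def is_image_def by blast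
qed

text \<open>
  The corestriction \<open>e\<close> of \<open>f\<close> to its image \<open>m\<close> is epi: if \<open>w \<cdot> e = 0\<close> then \<open>f\<close> factors through
  the subobject \<open>m \<cdot> n\<close> with \<open>n\<close> the kernel of \<open>w\<close>, and minimality of the image forces \<open>n\<close> to be
  split epi, hence \<open>w = 0\<close>.
\<close>
lemma exact_atE:
  assumes ex: "exact_at C f g" and f: "f \<in> homset C A B" and g: "g \<in> homset C B B'"
  obtains k K e where "is_kernel C k g" "k \<in> homset C K B"
    "is_epi C e" "e \<in> homset C A K" "f = k \<cdot> e"
proof -
  obtain m c where c: "is_cokernel C c f" and mc: "is_kernel C m c" and mg: "is_kernel C m g"
    using ex unfolding exact_at_def is_image_def by blast
  note ch = cokernel_hom[OF c f] and mh = kernel_hom[OF mg g] and mm = kernel_mono[OF mg]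
  let ?M = "Dom C m"
  obtain e where e: "e \<in> homset C A ?M" "m \<cdot> e = f"
    using kernel_factor[OF mc mh ch f cokernel_Comp[OF c f ch]] .
  have "is_epi C e"
  proof (rule epiI[OF e(1)])
    fix W w assume w: "w \<in> homset C ?M W" and 0: "w \<cdot> e = Zer C A W"
    obtain n where n: "is_kernel C n w" using ex_kernel hom_Arr[OF w] by blast
    note nh = kernel_hom[OF n w] and nm = kernel_mono[OF n]
    let ?N = "Dom C n"
    obtain e' where e': "e' \<in> homset C A ?N" "n \<cdot> e' = e"
      using kernel_factor[OF n nh w e(1) 0] .
    have mn: "m \<cdot> n \<in> homset C ?N B" using Comp_closed[OF nh mh] .
    \<comment> \<open>Minimality of the image: \<open>h\<close> kills \<open>f\<close>, hence factors through its cokernel \<open>c\<close> and kills \<open>m\<close>.\<close>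
    obtain h where h: "is_kernel C (m \<cdot> n) h"
      using mono_normal[OF mono_Comp[OF nh mh nm mm]] by blast
    have hh: "h \<in> homset C B (Cod C h)" using h mn by (auto simp: is_kernel_def homset_def)
    have "h \<cdot> f = Zer C A (Cod C h)"
    proof -
      have "f = (m \<cdot> n) \<cdot> e'" using Comp_assoc[OF e'(1) nh mh] e' e by simp
      then have "h \<cdot> f = (h \<cdot> (m \<cdot> n)) \<cdot> e'" using Comp_assoc[OF e'(1) mn hh] by simp
      then show ?thesis using kernel_Comp[OF h mn hh] Zer_Comp[OF e'(1)] hom_Obj[OF hh] by simp
    qed
    then obtain h' where h': "h' \<in> homset C (Cod C c) (Cod C h)" "h' \<cdot> c = h"
      using cokernel_factor[OF c f ch hh] by blast
    have "h \<cdot> m = Zer C ?M (Cod C h)"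
      using Comp_assoc[OF mh ch h'(1)] h' kernel_Comp[OF mc mh ch] Comp_Zer[OF h'(1)]
        hom_Obj[OF mh] by simp
    then obtain t where t: "t \<in> homset C ?M ?N" "(m \<cdot> n) \<cdot> t = m"
      using kernel_factor[OF h mn hh mh] by blast
    have M: "?M \<in> Obj C" using hom_Obj[OF mh] by blast
    have nt: "n \<cdot> t \<in> homset C ?M ?M" using Comp_closed[OF t(1) nh] .
    have "m \<cdot> (n \<cdot> t) = m \<cdot> Id C ?M"
      using t Comp_assoc[OF t(1) nh mh] Comp_Id[OF mh] by simp
    then have "n \<cdot> t = Id C ?M" using mono_cancel[OF mm mh nt Id_closed[OF M]] by blast
    then have "w = (w \<cdot> n) \<cdot> t" using Comp_assoc[OF t(1) nh w] Comp_Id[OF w] by simp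
    then show "w = Zer C ?M W"
      using kernel_Comp[OF n nh w] Zer_Comp[OF t(1)] hom_Obj[OF w] by simp
  qed
  then show ?thesis using that mg mh e by blast
qed

lemma exact_zero_right:
  assumes Z: "zero_object C Z" and f: "f \<in> homset C A B"
  shows "exact_at C f (Zer C B Z) \<longleftrightarrow> is_epi C f"
proof
  have o: "B \<in> Obj C" "Z \<in> Obj C" using f Z hom_Obj zero_object_Obj by blast+
  note zh = Zer_closed[OF o]
  { assume "is_epi C f"
    then have "exact_at C (Id C B \<cdot> f) (Zer C B Z)"
      using exact_atI[OF Id_kernel_zero[OF Z o(1)] Id_closed[OF o(1)] _ f] by blast
    then show "exact_at C f (Zer C B Z)" using Id_Comp[OF f] by simp }
  assume "exact_at C f (Zer C B Z)"
  from exact_atE[OF this f zh] obtain k K e where k: "is_kernel C k (Zer C B Z)" "k \<in> homset C K B"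
    and e: "is_epi C e" "e \<in> homset C A K" "f = k \<cdot> e" by blast
  obtain s where s: "s \<in> homset C B K" "k \<cdot> s = Id C B"
    using kernel_factor[OF k zh Id_closed[OF o(1)] Comp_Id[OF zh]] .
  show "is_epi C f"
  proof (rule epiI[OF f])
    fix X g assume g: "g \<in> homset C B X" and 0: "g \<cdot> f = Zer C A X"
    have "(g \<cdot> k) \<cdot> e = Zer C A X" using 0 e Comp_assoc[OF e(2) k(2) g] by simp
    then have "g \<cdot> k = Zer C K X" using epi_cancel_Zer[OF e(1,2) Comp_closed[OF k(2) g]] by blast
    then have "g \<cdot> (k \<cdot> s) = Zer C B X"
      using Comp_assoc[OF s(1) k(2) g] Zer_Comp[OF s(1)] hom_Obj[OF g] by simp
    then show "g = Zer C B X" using s Comp_Id[OF g] by simp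
  qed
qed

lemma exact_zero_left:
  assumes Z: "zero_object C Z" and f: "f \<in> homset C A B"
  shows "exact_at C (Zer C Z A) f \<longleftrightarrow> is_mono C f"
proof
  have o: "A \<in> Obj C" "Z \<in> Obj C" using f Z hom_Obj zero_object_Obj by blast+
  note zh = Zer_closed[OF o(2,1)]
  { assume "is_mono C f"
    then have "exact_at C (Zer C Z A \<cdot> Id C Z) f"
      using exact_atI[OF zero_mono_kernel[OF Z f] zh Id_epi[OF o(2)] Id_closed[OF o(2)]] by blast
    then show "exact_at C (Zer C Z A) f" using Comp_Id[OF zh] by simp }
  assume "exact_at C (Zer C Z A) f"
  from exact_atE[OF this zh f] obtain k K e where k: "is_kernel C k f" "k \<in> homset C K A"
    and e: "is_epi C e" "e \<in> homset C Z K" "Zer C Z A = k \<cdot> e" by blast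
  have k0: "k = Zer C K A" using epi_cancel_Zer[OF e(1,2) k(2)] e by simp
  show "is_mono C f"
  proof (rule monoI[OF f])
    fix X g assume g: "g \<in> homset C X A" and 0: "f \<cdot> g = Zer C X B"
    obtain h where "h \<in> homset C X K" "k \<cdot> h = g" using kernel_factor[OF k f g 0] .
    then show "g = Zer C X A" using k0 Zer_Comp o by auto
  qed
qed

lemma ses_hom:
  assumes "ses C k e"
  obtains K A B where "k \<in> homset C K A" "e \<in> homset C A B"
  using assms unfolding ses_def is_kernel_def homset_def by blast

lemma short_exact_iff_ses: "short_exact C f g \<longleftrightarrow> ses C f g"
proof
  assume "short_exact C f g"
  then obtain Z Z' where Z: "zero_object C Z" "zero_object C Z'"
    and ex: "exact_at C (Zer C Z (Dom C f)) f" "exact_at C f g" "exact_at C g (Zer C (Cod C g) Z')"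
    unfolding short_exact_def by blast
  obtain A B B' where f: "f \<in> homset C A B" and g: "g \<in> homset C B B'"
    using ex(2) unfolding exact_at_def is_image_def is_kernel_def is_cokernel_def homset_def by auto
  have m: "is_mono C f" using exact_zero_left[OF Z(1) f] ex(1) hom_Dom[OF f] by simp
  have e: "is_epi C g" using exact_zero_right[OF Z(2) g] ex(3) hom_Cod[OF g] by simp
  obtain n c where c: "is_cokernel C c f" and nc: "is_kernel C n c" and ng: "is_kernel C n g"
    using ex(2) unfolding exact_at_def is_image_def by blast
  note ch = cokernel_hom[OF c f] and nh = kernel_hom[OF ng g]
  have fc: "is_kernel C f c" using kernel_of_cokernel[OF m f c ch] .
  have "is_kernel C f g"
  proof (rule kernelI[OF f g _ m])
    obtain h where h: "h \<in> homset C A (Dom C n)" "n \<cdot> h = f"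
      using kernel_factor[OF nc nh ch f kernel_Comp[OF fc f ch]] .
    show "g \<cdot> f = Zer C A B'"
      using h Comp_assoc[OF h(1) nh g] kernel_Comp[OF ng nh g] Zer_Comp[OF h(1)] hom_Obj[OF g]
      by simp
    fix X t assume t: "t \<in> homset C X B" and 0: "g \<cdot> t = Zer C X B'"
    obtain u where u: "u \<in> homset C X (Dom C n)" "n \<cdot> u = t" using kernel_factor[OF ng nh g t 0] .
    have "c \<cdot> t = Zer C X (Cod C c)"
      using u Comp_assoc[OF u(1) nh ch] kernel_Comp[OF nc nh ch] Zer_Comp[OF u(1)] hom_Obj[OF ch]
      by simp
    then show "\<exists>h \<in> homset C X A. f \<cdot> h = t" using kernel_factor[OF fc f ch t] by blast
  qed
  then show "ses C f g" using e unfolding ses_def by blast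
next
  assume s: "ses C f g"
  obtain A B B' where f: "f \<in> homset C A B" and g: "g \<in> homset C B B'" using ses_hom[OF s] .
  have k: "is_kernel C f g" and e: "is_epi C g" using s unfolding ses_def by auto
  have o: "A \<in> Obj C" using hom_Obj[OF f] by blast
  obtain Z where Z: "zero_object C Z" using ex_zero_object by blast
  have "exact_at C (f \<cdot> Id C A) g" using exact_atI[OF k f Id_epi[OF o] Id_closed[OF o]] .
  then have "exact_at C f g" using Comp_Id[OF f] by simp
  moreover have "exact_at C (Zer C Z (Dom C f)) f"
    using exact_zero_left[OF Z f] kernel_mono[OF k] hom_Dom[OF f] by simp
  moreover have "exact_at C g (Zer C (Cod C g) Z)"
    using exact_zero_right[OF Z g] e hom_Cod[OF g] by simp
  ultimately show "short_exact C f g" using Z unfolding short_exact_def by blast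
qed

end

section \<open>Biproducts and projective objects\<close>

lemma projective_Obj: "projective C P \<Longrightarrow> P \<in> Obj C"
  by (simp add: projective_def)

definition biproduct ::
  "('o, 'm, 'z) preadditive_cat_scheme \<Rightarrow> 'o \<Rightarrow> 'o \<Rightarrow> 'o \<Rightarrow> 'm \<Rightarrow> 'm \<Rightarrow> 'm \<Rightarrow> 'm \<Rightarrow> bool" where
  "biproduct C A B S i j p q \<longleftrightarrow>
     i \<in> homset C A S \<and> j \<in> homset C B S \<and> p \<in> homset C S A \<and> q \<in> homset C S B \<and>
     p \<cdot>\<^bsub>C\<^esub> i = Id C A \<and> q \<cdot>\<^bsub>C\<^esub> j = Id C B \<and>
     p \<cdot>\<^bsub>C\<^esub> j = Zer C B A \<and> q \<cdot>\<^bsub>C\<^esub> i = Zer C A B \<and>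
     (i \<cdot>\<^bsub>C\<^esub> p) \<uplus>\<^bsub>C\<^esub> (j \<cdot>\<^bsub>C\<^esub> q) = Id C S"

context abelian_category
begin

lemma split_epi:
  assumes f: "f \<in> homset C A B" and s: "s \<in> homset C B A" and fs: "f \<cdot> s = Id C B"
  shows "is_epi C f"
proof (rule epiI[OF f])
  fix X g assume g: "g \<in> homset C B X" and 0: "g \<cdot> f = Zer C A X"
  have "g = (g \<cdot> f) \<cdot> s" using Comp_assoc[OF s f g] fs Comp_Id[OF g] by simp
  then show "g = Zer C B X" using 0 Zer_Comp[OF s] hom_Obj[OF g] by simp
qed

lemma split_mono:
  assumes f: "f \<in> homset C A B" and s: "s \<in> homset C B A" and sf: "s \<cdot> f = Id C A"
  shows "is_mono C f"
proof -
  have "is_mono C (s \<cdot> f)" using Id_mono hom_Obj[OF f] sf by simp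
  then show ?thesis using mono_Comp_left[OF f s] by blast
qed

lemma biproduct_decompose:
  assumes b: "biproduct C A B S i j p q" and x: "x \<in> homset C X S"
  shows "x = (i \<cdot> (p \<cdot> x)) \<uplus> (j \<cdot> (q \<cdot> x))"
proof -
  have h: "i \<in> homset C A S" "j \<in> homset C B S" "p \<in> homset C S A" "q \<in> homset C S B"
    and e: "(i \<cdot> p) \<uplus> (j \<cdot> q) = Id C S" using b unfolding biproduct_def by auto
  have "x = ((i \<cdot> p) \<uplus> (j \<cdot> q)) \<cdot> x" using e Id_Comp[OF x] by simp
  also have "\<dots> = ((i \<cdot> p) \<cdot> x) \<uplus> ((j \<cdot> q) \<cdot> x)"
    using Add_Comp[OF x Comp_closed[OF h(3,1)] Comp_closed[OF h(4,2)]] .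
  also have "\<dots> = (i \<cdot> (p \<cdot> x)) \<uplus> (j \<cdot> (q \<cdot> x))"
    using Comp_assoc[OF x h(3,1)] Comp_assoc[OF x h(4,2)] by simp
  finally show ?thesis .
qed

lemma biproduct_codecompose:
  assumes b: "biproduct C A B S i j p q" and x: "x \<in> homset C S X"
  shows "x = ((x \<cdot> i) \<cdot> p) \<uplus> ((x \<cdot> j) \<cdot> q)"
proof -
  have h: "i \<in> homset C A S" "j \<in> homset C B S" "p \<in> homset C S A" "q \<in> homset C S B"
    and e: "(i \<cdot> p) \<uplus> (j \<cdot> q) = Id C S" using b unfolding biproduct_def by auto
  have "x = x \<cdot> ((i \<cdot> p) \<uplus> (j \<cdot> q))" using e Comp_Id[OF x] by simp
  also have "\<dots> = (x \<cdot> (i \<cdot> p)) \<uplus> (x \<cdot> (j \<cdot> q))"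
    using Comp_Add[OF Comp_closed[OF h(3,1)] Comp_closed[OF h(4,2)] x] .
  also have "\<dots> = ((x \<cdot> i) \<cdot> p) \<uplus> ((x \<cdot> j) \<cdot> q)"
    using Comp_assoc[OF h(3,1) x] Comp_assoc[OF h(4,2) x] by simp
  finally show ?thesis .
qed

lemma biproduct_joint_epi:
  assumes b: "biproduct C A B S i j p q" and x: "x \<in> homset C S X"
    and 0: "x \<cdot> i = Zer C A X" "x \<cdot> j = Zer C B X"
  shows "x = Zer C S X"
proof -
  have h: "p \<in> homset C S A" "q \<in> homset C S B" using b unfolding biproduct_def by auto
  have o: "S \<in> Obj C" "X \<in> Obj C" using hom_Obj[OF x] .
  have "x = Zer C S X \<uplus> Zer C S X"
    using biproduct_codecompose[OF b x] 0 Zer_Comp[OF h(1)] Zer_Comp[OF h(2)] o by simp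
  then show ?thesis using Add_Zer Zer_closed[OF o] by simp
qed

lemma biproduct_ses:
  assumes b: "biproduct C A B S i j p q"
  shows "ses C i q"
  unfolding ses_def
proof
  have h: "i \<in> homset C A S" "j \<in> homset C B S" "p \<in> homset C S A" "q \<in> homset C S B"
    and e: "p \<cdot> i = Id C A" "q \<cdot> j = Id C B" "q \<cdot> i = Zer C A B"
    using b unfolding biproduct_def by auto
  show "is_epi C q" using split_epi[OF h(4,2) e(2)] .
  show "is_kernel C i q"
  proof (rule kernelI[OF h(1,4) e(3) split_mono[OF h(1,3) e(1)]])
    fix X x assume x: "x \<in> homset C X S" and 0: "q \<cdot> x = Zer C X B"
    note px = Comp_closed[OF x h(3)]
    have "x = (i \<cdot> (p \<cdot> x)) \<uplus> Zer C X S"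
      using biproduct_decompose[OF b x] 0 Comp_Zer[OF h(2)] hom_Obj[OF x] by simp
    then have "i \<cdot> (p \<cdot> x) = x" using Add_Zer[OF Comp_closed[OF px h(1)]] by simp
    then show "\<exists>h \<in> homset C X A. i \<cdot> h = x" using px by blast
  qed
qed

lemma obtain_biproduct:
  assumes "A \<in> Obj C" "B \<in> Obj C"
  obtains S i j p q where "biproduct C A B S i j p q"
proof -
  obtain S i j p q where "biproduct C A B S i j p q"
    using ex_biproduct[OF assms] unfolding has_biproduct_def biproduct_def by blast
  then show ?thesis by (rule that)
qed

lemma projective_lift:
  assumes "projective C P" "is_epi C e" "e \<in> homset C A B" "f \<in> homset C P B"
  obtains g where "g \<in> homset C P A" "e \<cdot> g = f"
proof -
  have "\<exists>g \<in> homset C P (Dom C e). e \<cdot> g = f"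
    using assms(1,2,4) hom_Cod[OF assms(3)] unfolding projective_def by blast
  then show ?thesis using that hom_Dom[OF assms(3)] by blast
qed

lemma projectiveI:
  assumes "P \<in> Obj C"
    and "\<And>e f A B. \<lbrakk>is_epi C e; e \<in> homset C A B; f \<in> homset C P B\<rbrakk>
      \<Longrightarrow> \<exists>g \<in> homset C P A. e \<cdot> g = f"
  shows "projective C P"
  unfolding projective_def
proof (intro conjI allI impI)
  fix e f assume "is_epi C e \<and> f \<in> homset C P (Cod C e)"
  moreover from this have "e \<in> homset C (Dom C e) (Cod C e)"
    by (simp add: is_epi_def homset_def)
  ultimately show "\<exists>g \<in> homset C P (Dom C e). e \<cdot> g = f" using assms(2) by blast
qed (rule assms(1))

lemma retract_projective:
  assumes P: "projective C P" and r: "r \<in> homset C P A" and s: "s \<in> homset C A P"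
    and rs: "r \<cdot> s = Id C A"
  shows "projective C A"
proof (rule projectiveI)
  show "A \<in> Obj C" using hom_Obj[OF r] by blast
  fix e f X Y assume e: "is_epi C e" "e \<in> homset C X Y" and f: "f \<in> homset C A Y"
  obtain g where g: "g \<in> homset C P X" "e \<cdot> g = f \<cdot> r"
    using projective_lift[OF P e Comp_closed[OF r f]] .
  have "e \<cdot> (g \<cdot> s) = (f \<cdot> r) \<cdot> s" using Comp_assoc[OF s g(1) e(2)] g by simp
  also have "\<dots> = f" using Comp_assoc[OF s r f] rs Comp_Id[OF f] by simp
  finally show "\<exists>g \<in> homset C A X. e \<cdot> g = f" using Comp_closed[OF s g(1)] by blast
qed

lemma biproduct_projective:
  assumes b: "biproduct C A B S i j p q" and A: "projective C A" and B: "projective C B"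
  shows "projective C S"
proof (rule projectiveI)
  have h: "i \<in> homset C A S" "j \<in> homset C B S" "p \<in> homset C S A" "q \<in> homset C S B"
    using b unfolding biproduct_def by auto
  show "S \<in> Obj C" using hom_Obj[OF h(1)] by blast
  fix e f X Y assume e: "is_epi C e" "e \<in> homset C X Y" and f: "f \<in> homset C S Y"
  obtain g where g: "g \<in> homset C A X" "e \<cdot> g = f \<cdot> i"
    using projective_lift[OF A e Comp_closed[OF h(1) f]] .
  obtain g' where g': "g' \<in> homset C B X" "e \<cdot> g' = f \<cdot> j"
    using projective_lift[OF B e Comp_closed[OF h(2) f]] .
  note gp = Comp_closed[OF h(3) g(1)] and gq = Comp_closed[OF h(4) g'(1)]
  have "e \<cdot> ((g \<cdot> p) \<uplus> (g' \<cdot> q)) = ((f \<cdot> i) \<cdot> p) \<uplus> ((f \<cdot> j) \<cdot> q)"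
    using Comp_Add[OF gp gq e(2)] Comp_assoc[OF h(3) g(1) e(2)] Comp_assoc[OF h(4) g'(1) e(2)] g g'
    by simp
  also have "\<dots> = f" using biproduct_codecompose[OF b f] by simp
  finally show "\<exists>g \<in> homset C S X. e \<cdot> g = f" using Add_closed[OF gp gq] by blast
qed

text \<open>
  A section \<open>s\<close> of \<open>e\<close> comes from lifting the identity of \<open>Q\<close>; the retraction \<open>r\<close> is then the
  factorisation of \<open>Id - s \<cdot> e\<close> through the kernel \<open>k\<close>.
\<close>
lemma ses_projective_splits:
  assumes ses: "ses C k e" and k: "k \<in> homset C L M" and e: "e \<in> homset C M Q"
    and Q: "projective C Q"
  obtains s r where "biproduct C L Q M k s r e"
proof -
  have ker: "is_kernel C k e" and epi: "is_epi C e" using ses unfolding ses_def by auto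
  have o: "L \<in> Obj C" "M \<in> Obj C" "Q \<in> Obj C" using hom_Obj k e by blast+
  note km = kernel_mono[OF ker] and ek = kernel_Comp[OF ker k e]
  obtain s where s: "s \<in> homset C Q M" "e \<cdot> s = Id C Q"
    using projective_lift[OF Q epi e Id_closed[OF o(3)]] .
  note se = Comp_closed[OF e s(1)] and id = Id_closed[OF o(2)]
  have ese: "e \<cdot> (s \<cdot> e) = e" using Comp_assoc[OF e s(1) e] s Id_Comp[OF e] by simp
  \<comment> \<open>\<open>n\<close> is \<open>- (s \<cdot> e)\<close>.\<close>
  obtain n where n: "n \<in> homset C M M" "(s \<cdot> e) \<uplus> n = Zer C M M" "n \<uplus> (s \<cdot> e) = Zer C M M"
    using ex_neg[OF se] .
  have "e \<cdot> (Id C M \<uplus> n) = (e \<cdot> (s \<cdot> e)) \<uplus> (e \<cdot> n)"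
    using Comp_Add[OF id n(1) e] Comp_Id[OF e] ese by simp
  also have "\<dots> = Zer C M Q"
    using Comp_Add[OF se n(1) e] n Comp_Zer[OF e o(2)] by simp
  finally obtain r where r: "r \<in> homset C M L" "k \<cdot> r = Id C M \<uplus> n"
    using kernel_factor[OF ker k e Add_closed[OF id n(1)]] by blast
  note kr = Comp_closed[OF r(1) k]
  have sum: "(k \<cdot> r) \<uplus> (s \<cdot> e) = Id C M"
    using r Add_assoc[OF id n(1) se] n Add_Zer[OF id] by simp
  have rk: "r \<cdot> k = Id C L"
  proof (rule mono_cancel[OF km k Comp_closed[OF k r(1)] Id_closed[OF o(1)]])
    have "k = ((k \<cdot> r) \<uplus> (s \<cdot> e)) \<cdot> k" using sum Id_Comp[OF k] by simp
    also have "\<dots> = (k \<cdot> (r \<cdot> k)) \<uplus> Zer C L M"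
      using Add_Comp[OF k kr se] Comp_assoc[OF k r(1) k] Comp_assoc[OF k e s(1)] ek
        Comp_Zer[OF s(1) o(1)] by simp
    also have "\<dots> = k \<cdot> (r \<cdot> k)"
      using Add_Zer[OF Comp_closed[OF Comp_closed[OF k r(1)] k]] by simp
    finally show "k \<cdot> (r \<cdot> k) = k \<cdot> Id C L" using Comp_Id[OF k] by simp
  qed
  have rs: "r \<cdot> s = Zer C Q L"
  proof (rule mono_cancel_Zer[OF km k Comp_closed[OF s(1) r(1)]])
    note krs = Comp_closed[OF Comp_closed[OF s(1) r(1)] k]
    have "s = ((k \<cdot> r) \<uplus> (s \<cdot> e)) \<cdot> s" using sum Id_Comp[OF s(1)] by simp
    also have "\<dots> = (k \<cdot> (r \<cdot> s)) \<uplus> s"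
      using Add_Comp[OF s(1) kr se] Comp_assoc[OF s(1) r(1) k] Comp_assoc[OF s(1) e s(1)] s
        Comp_Id[OF s(1)] by simp
    finally have "s \<uplus> (k \<cdot> (r \<cdot> s)) = s \<uplus> Zer C Q M"
      using Add_commute[OF s(1) krs] Add_Zer[OF s(1)] by simp
    then show "k \<cdot> (r \<cdot> s) = Zer C Q M"
      using Add_left_cancel[OF s(1) krs] Zer_closed[OF o(3,2)] by blast
  qed
  have "biproduct C L Q M k s r e"
    unfolding biproduct_def using k s r(1) e rk rs ek sum by blast
  then show ?thesis by (rule that)
qed

end

section \<open>Syzygies and dimension\<close>

text \<open>
  The recursion peels off the syzygies of a resolution one at a time, so that inductions run over
  short exact sequences.  It describes resolutions of length \<open>n\<close>, whose terms may vanish; hence the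
  name.
\<close>
primrec pdim_le :: "('o, 'm, 'z) preadditive_cat_scheme \<Rightarrow> nat \<Rightarrow> 'o \<Rightarrow> bool" where
  "pdim_le C 0 A \<longleftrightarrow> projective C A"
| "pdim_le C (Suc n) A \<longleftrightarrow> (\<exists>k e K P. ses C k e \<and> k \<in> homset C K P \<and> e \<in> homset C P A \<and>
     projective C P \<and> pdim_le C n K)"

context abelian_category
begin

text \<open>
  From a presentation \<open>N \<rightarrow> P \<rightarrow> M\<close> one passes to \<open>N \<rightarrow> P' \<rightarrow> L\<close>, where \<open>P'\<close> is the preimage of \<open>L\<close>
  in \<open>P\<close>, that is, the kernel of \<open>P \<rightarrow> M \<rightarrow> Q\<close>.  It is a direct summand of \<open>P\<close> because \<open>Q\<close> is
  projective, and the syzygy \<open>N\<close> is unchanged.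
\<close>
lemma pdim_le_of_ses_middle:
  assumes ses: "ses C k e" and k: "k \<in> homset C L M" and e: "e \<in> homset C M Q"
    and Q: "projective C Q" and M: "pdim_le C n M"
  shows "pdim_le C n L"
proof (cases n)
  case 0
  obtain s r where "biproduct C L Q M k s r e" using ses_projective_splits[OF ses k e Q] .
  then have "r \<in> homset C M L" "r \<cdot> k = Id C L" unfolding biproduct_def by auto
  then show ?thesis using retract_projective[OF _ _ k] M 0 by simp
next
  case (Suc m)
  obtain j p N P where jp: "ses C j p" and j: "j \<in> homset C N P" and p: "p \<in> homset C P M"
    and P: "projective C P" and N: "pdim_le C m N" using M Suc by auto
  have jker: "is_kernel C j p" and pepi: "is_epi C p" using jp unfolding ses_def by auto
  have kker: "is_kernel C k e" and eepi: "is_epi C e" using ses unfolding ses_def by auto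
  note km = kernel_mono[OF kker]
  obtain s r where b: "biproduct C L Q M k s r e" using ses_projective_splits[OF ses k e Q] .
  have r: "r \<in> homset C M L" and rk: "r \<cdot> k = Id C L" using b unfolding biproduct_def by auto
  have ep: "e \<cdot> p \<in> homset C P Q" using Comp_closed[OF p e] .
  have epepi: "is_epi C (e \<cdot> p)"
  proof (rule epiI[OF ep])
    fix X g assume g: "g \<in> homset C Q X" and "g \<cdot> (e \<cdot> p) = Zer C P X"
    then have "(g \<cdot> e) \<cdot> p = Zer C P X" using Comp_assoc[OF p e g] by simp
    then have "g \<cdot> e = Zer C M X" using epi_cancel_Zer[OF pepi p Comp_closed[OF e g]] by blast
    then show "g = Zer C Q X" using epi_cancel_Zer[OF eepi e g] by blast
  qed
  obtain i where iker: "is_kernel C i (e \<cdot> p)" using ex_kernel hom_Arr[OF ep] by blast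
  define P' where "P' = Dom C i"
  have i: "i \<in> homset C P' P" using kernel_hom[OF iker ep] unfolding P'_def .
  note im = kernel_mono[OF iker]
  have ies: "ses C i (e \<cdot> p)" using iker epepi unfolding ses_def by blast
  obtain s' r' where b': "biproduct C P' Q P i s' r' (e \<cdot> p)"
    using ses_projective_splits[OF ies i ep Q] .
  have r': "r' \<in> homset C P P'" and r'i: "r' \<cdot> i = Id C P'" using b' unfolding biproduct_def by auto
  have P': "projective C P'" using retract_projective[OF P r' i r'i] .
  have epi0: "e \<cdot> (p \<cdot> i) = Zer C P' Q"
    using kernel_Comp[OF iker i ep] Comp_assoc[OF i p e] by simp
  obtain p' where p': "p' \<in> homset C P' L" and kp': "k \<cdot> p' = p \<cdot> i"
    using kernel_factor[OF kker k e Comp_closed[OF i p] epi0] .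
  have "(e \<cdot> p) \<cdot> j = Zer C N Q"
    using Comp_assoc[OF j p e] kernel_Comp[OF jker j p] Comp_Zer[OF e] hom_Obj[OF j] by simp
  then obtain j' where j': "j' \<in> homset C N P'" and ij': "i \<cdot> j' = j"
    using kernel_factor[OF iker i ep j] by blast
  have eq: "p' \<cdot> x = Zer C X L \<longleftrightarrow> p \<cdot> (i \<cdot> x) = Zer C X M" if x: "x \<in> homset C X P'" for X x
  proof -
    have *: "p \<cdot> (i \<cdot> x) = k \<cdot> (p' \<cdot> x)"
      using Comp_assoc[OF x i p] Comp_assoc[OF x p' k] kp' by simp
    show ?thesis
      unfolding * using mono_cancel_Zer[OF km k Comp_closed[OF x p']] Comp_Zer[OF k] hom_Obj[OF x]
      by metis
  qed
  have "is_kernel C j' p'"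
  proof (rule kernelI[OF j' p'])
    show "p' \<cdot> j' = Zer C N L" using eq[OF j'] ij' kernel_Comp[OF jker j p] by simp
    show "is_mono C j'" using mono_Comp_left[OF j' i] ij' kernel_mono[OF jker] by simp
    fix X x assume x: "x \<in> homset C X P'" and "p' \<cdot> x = Zer C X L"
    then have "p \<cdot> (i \<cdot> x) = Zer C X M" using eq[OF x] by blast
    then obtain y where y: "y \<in> homset C X N" "j \<cdot> y = i \<cdot> x"
      using kernel_factor[OF jker j p Comp_closed[OF x i]] by blast
    have "i \<cdot> (j' \<cdot> y) = i \<cdot> x" using y ij' Comp_assoc[OF y(1) j' i] by simp
    then have "j' \<cdot> y = x" using mono_cancel[OF im i Comp_closed[OF y(1) j'] x] by blast
    then show "\<exists>h \<in> homset C X N. j' \<cdot> h = x" using y by blast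
  qed
  moreover have "is_epi C p'"
  proof (rule epiI[OF p'])
    fix X w assume w: "w \<in> homset C L X" and 0: "w \<cdot> p' = Zer C P' X"
    note wr = Comp_closed[OF r w]
    \<comment> \<open>Extend \<open>w\<close> to \<open>M\<close> along the retraction \<open>r\<close>.  The extension, pulled back to \<open>P\<close>, kills \<open>P'\<close>,
      so it factors through \<open>Q\<close>, and its restriction \<open>w\<close> to \<open>L\<close> vanishes.\<close>
    have "p' = r \<cdot> (p \<cdot> i)" using Comp_assoc[OF p' k r] kp' rk Id_Comp[OF p'] by simp
    then have "w \<cdot> p' = (w \<cdot> r) \<cdot> (p \<cdot> i)" using Comp_assoc[OF Comp_closed[OF i p] r w] by simp
    then have "((w \<cdot> r) \<cdot> p) \<cdot> i = Zer C P' X" using 0 Comp_assoc[OF i p wr] by simp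
    then obtain v where v: "v \<in> homset C Q X" "v \<cdot> (e \<cdot> p) = (w \<cdot> r) \<cdot> p"
      using cokernel_factor[OF cokernel_of_kernel[OF epepi ep iker i] i ep Comp_closed[OF p wr]]
      by blast
    have ve: "v \<cdot> e = w \<cdot> r"
      using epi_cancel[OF pepi p Comp_closed[OF e v(1)] wr] v Comp_assoc[OF p e v(1)] by simp
    have "w = (w \<cdot> r) \<cdot> k" using Comp_assoc[OF k r w] rk Comp_Id[OF w] by simp
    also have "\<dots> = v \<cdot> (e \<cdot> k)" using ve Comp_assoc[OF k e v(1)] by simp
    also have "\<dots> = Zer C L X"
      using kernel_Comp[OF kker k e] Comp_Zer[OF v(1)] hom_Obj[OF k] by simp
    finally show "w = Zer C L X" .
  qed
  ultimately show ?thesis unfolding Suc pdim_le.simps ses_def using j' p' P' N by blast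
qed

text \<open>
  From a presentation \<open>N \<rightarrow> P \<rightarrow> L\<close> one passes to \<open>N \<rightarrow> P \<oplus> Q \<rightarrow> M\<close>, the map on \<open>Q\<close> being a section of
  \<open>M \<rightarrow> Q\<close>; again the syzygy \<open>N\<close> is unchanged.
\<close>
lemma pdim_le_of_ses_left:
  assumes ses: "ses C k e" and k: "k \<in> homset C L M" and e: "e \<in> homset C M Q"
    and Q: "projective C Q" and L: "pdim_le C n L"
  shows "pdim_le C n M"
proof -
  obtain s r where b: "biproduct C L Q M k s r e" using ses_projective_splits[OF ses k e Q] .
  show ?thesis
  proof (cases n)
    case 0
    then show ?thesis using biproduct_projective[OF b _ Q] L by simp
  next
    case (Suc m)
    obtain j p N P where jp: "ses C j p" and j: "j \<in> homset C N P" and p: "p \<in> homset C P L"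
      and P: "projective C P" and N: "pdim_le C m N" using L Suc by auto
    have jker: "is_kernel C j p" and pepi: "is_epi C p" using jp unfolding ses_def by auto
    have kker: "is_kernel C k e" using ses unfolding ses_def by auto
    have s: "s \<in> homset C Q M" and es: "e \<cdot> s = Id C Q" and ek: "e \<cdot> k = Zer C L Q"
      using b unfolding biproduct_def by auto
    have o: "P \<in> Obj C" "Q \<in> Obj C" using projective_Obj[OF P] projective_Obj[OF Q] .
    obtain S i1 i2 p1 p2 where b': "biproduct C P Q S i1 i2 p1 p2" using obtain_biproduct[OF o] .
    have i1: "i1 \<in> homset C P S" and i2: "i2 \<in> homset C Q S"
      and p1: "p1 \<in> homset C S P" and p2: "p2 \<in> homset C S Q"
      and eqs: "p1 \<cdot> i1 = Id C P" "p2 \<cdot> i2 = Id C Q" "p1 \<cdot> i2 = Zer C Q P" "p2 \<cdot> i1 = Zer C P Q"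
      using b' unfolding biproduct_def by auto
    have S: "S \<in> Obj C" using hom_Obj[OF i1] by blast
    have kp: "k \<cdot> p \<in> homset C P M" using Comp_closed[OF p k] .
    define u where "u = ((k \<cdot> p) \<cdot> p1) \<uplus> (s \<cdot> p2)"
    note ua = Comp_closed[OF p1 kp] and ub = Comp_closed[OF p2 s]
    have u: "u \<in> homset C S M" unfolding u_def using Add_closed[OF ua ub] .
    have ux: "u \<cdot> x = (k \<cdot> (p \<cdot> (p1 \<cdot> x))) \<uplus> (s \<cdot> (p2 \<cdot> x))" if x: "x \<in> homset C X S" for x X
    proof -
      have "((k \<cdot> p) \<cdot> p1) \<cdot> x = k \<cdot> (p \<cdot> (p1 \<cdot> x))"
        using Comp_assoc[OF x p1 kp] Comp_assoc[OF Comp_closed[OF x p1] p k] by simp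
      then show ?thesis unfolding u_def using Add_Comp[OF x ua ub] Comp_assoc[OF x p2 s] by simp
    qed
    have ui1: "u \<cdot> i1 = k \<cdot> p"
      using ux[OF i1] eqs Comp_Id[OF p] Comp_Zer[OF s o(1)] Add_Zer[OF kp] by simp
    have ui2: "u \<cdot> i2 = s"
      using ux[OF i2] eqs Comp_Id[OF s] Comp_Zer[OF p o(2)] Comp_Zer[OF k o(2)] Add_Zer[OF s] by simp
    have eu: "e \<cdot> u = p2"
    proof -
      have "e \<cdot> ((k \<cdot> p) \<cdot> p1) = Zer C S Q"
        using Comp_assoc[OF p1 kp e] Comp_assoc[OF p k e] ek Zer_Comp[OF p o(2)] Zer_Comp[OF p1 o(2)]
        by simp
      moreover have "e \<cdot> (s \<cdot> p2) = p2" using Comp_assoc[OF p2 s e] es Id_Comp[OF p2] by simp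
      ultimately show ?thesis unfolding u_def using Comp_Add[OF ua ub e] Add_Zer[OF p2] by simp
    qed
    have ij: "i1 \<cdot> j \<in> homset C N S" using Comp_closed[OF j i1] .
    have "is_kernel C (i1 \<cdot> j) u"
    proof (rule kernelI[OF ij u])
      show "u \<cdot> (i1 \<cdot> j) = Zer C N M"
        using Comp_assoc[OF j i1 u] ui1 Comp_assoc[OF j p k] kernel_Comp[OF jker j p]
          Comp_Zer[OF k] hom_Obj[OF j] by simp
      show "is_mono C (i1 \<cdot> j)"
        using mono_Comp[OF j i1 kernel_mono[OF jker] split_mono[OF i1 p1 eqs(1)]] .
      fix X x assume x: "x \<in> homset C X S" and 0: "u \<cdot> x = Zer C X M"
      have X: "X \<in> Obj C" using hom_Obj[OF x] by blast
      note p1x = Comp_closed[OF x p1]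
      have p2x: "p2 \<cdot> x = Zer C X Q" using eu Comp_assoc[OF x u e] 0 Comp_Zer[OF e X] by simp
      then have "k \<cdot> (p \<cdot> (p1 \<cdot> x)) = Zer C X M"
        using ux[OF x] 0 Comp_Zer[OF s X] Add_Zer[OF Comp_closed[OF Comp_closed[OF p1x p] k]] by simp
      then have "p \<cdot> (p1 \<cdot> x) = Zer C X L"
        using mono_cancel_Zer[OF kernel_mono[OF kker] k Comp_closed[OF p1x p]] by blast
      then obtain y where y: "y \<in> homset C X N" "j \<cdot> y = p1 \<cdot> x"
        using kernel_factor[OF jker j p p1x] by blast
      have "x = i1 \<cdot> (p1 \<cdot> x)"
        using biproduct_decompose[OF b' x] p2x Comp_Zer[OF i2 X] Add_Zer[OF Comp_closed[OF p1x i1]]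
        by simp
      then have "(i1 \<cdot> j) \<cdot> y = x" using y Comp_assoc[OF y(1) j i1] by simp
      then show "\<exists>h \<in> homset C X N. (i1 \<cdot> j) \<cdot> h = x" using y by blast
    qed
    moreover have "is_epi C u"
    proof (rule epiI[OF u])
      fix X w assume w: "w \<in> homset C M X" and 0: "w \<cdot> u = Zer C S X"
      have X: "X \<in> Obj C" using hom_Obj[OF w] by blast
      have "(w \<cdot> k) \<cdot> p = Zer C P X"
        using Comp_assoc[OF p k w] ui1 Comp_assoc[OF i1 u w] 0 Zer_Comp[OF i1 X] by simp
      then have "w \<cdot> k = Zer C L X" using epi_cancel_Zer[OF pepi p Comp_closed[OF k w]] by blast
      moreover have "w \<cdot> s = Zer C Q X"
        using ui2 Comp_assoc[OF i2 u w] 0 Zer_Comp[OF i2 X] by simp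
      ultimately show "w = Zer C M X" using biproduct_joint_epi[OF b w] by blast
    qed
    ultimately show ?thesis
      unfolding Suc pdim_le.simps ses_def using ij u biproduct_projective[OF b' P Q] N by blast
  qed
qed

text \<open>
  Schanuel's argument.  Let \<open>K' \<rightarrow> P' \<rightarrow> A\<close> be the presentation witnessing the hypothesis and lift
  \<open>P' \<rightarrow> A\<close> to \<open>u: P' \<rightarrow> P\<close>.  The map \<open>v = (k, u): K \<oplus> P' \<rightarrow> P\<close> is epi with kernel \<open>K'\<close>, so the bound
  passes from \<open>K'\<close> to \<open>K \<oplus> P'\<close> because \<open>P\<close> is projective, and from there to \<open>K\<close> because \<open>P'\<close> is
  projective.  The lift \<open>u\<close> makes the biproduct play the role of the pullback of \<open>P\<close> and \<open>P'\<close>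
  over \<open>A\<close>.
\<close>
lemma pdim_le_syzygy:
  assumes A: "pdim_le C (Suc n) A"
    and ses: "ses C k e" and k: "k \<in> homset C K P" and e: "e \<in> homset C P A"
    and P: "projective C P"
  shows "pdim_le C n K"
proof -
  obtain k' e' K' P' where ses': "ses C k' e'" and k': "k' \<in> homset C K' P'"
    and e': "e' \<in> homset C P' A" and P': "projective C P'" and K': "pdim_le C n K'"
    using A by auto
  have ker: "is_kernel C k e" and epi: "is_epi C e" using ses unfolding ses_def by auto
  have ker': "is_kernel C k' e'" and epi': "is_epi C e'" using ses' unfolding ses_def by auto
  have o: "K \<in> Obj C" "P' \<in> Obj C" "K' \<in> Obj C" using hom_Obj k k' by blast+
  obtain S i j p q where b: "biproduct C K P' S i j p q" using obtain_biproduct[OF o(1,2)] .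
  have i: "i \<in> homset C K S" and j: "j \<in> homset C P' S"
    and p: "p \<in> homset C S K" and q: "q \<in> homset C S P'"
    and eqs: "p \<cdot> i = Id C K" "q \<cdot> j = Id C P'" "p \<cdot> j = Zer C P' K" "q \<cdot> i = Zer C K P'"
    using b unfolding biproduct_def by auto
  obtain u where u: "u \<in> homset C P' P" and eu: "e \<cdot> u = e'"
    using projective_lift[OF P' epi e e'] .
  define v where "v = (k \<cdot> p) \<uplus> (u \<cdot> q)"
  note va = Comp_closed[OF p k] and vb = Comp_closed[OF q u]
  have v: "v \<in> homset C S P" unfolding v_def using Add_closed[OF va vb] .
  have vx: "v \<cdot> x = (k \<cdot> (p \<cdot> x)) \<uplus> (u \<cdot> (q \<cdot> x))" if x: "x \<in> homset C X S" for x X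
    unfolding v_def using Add_Comp[OF x va vb] Comp_assoc[OF x p k] Comp_assoc[OF x q u] by simp
  have vi: "v \<cdot> i = k" using vx[OF i] eqs Comp_Id[OF k] Comp_Zer[OF u o(1)] Add_Zer[OF k] by simp
  have vj: "v \<cdot> j = u" using vx[OF j] eqs Comp_Id[OF u] Comp_Zer[OF k o(2)] Add_Zer[OF u] by simp
  have "e \<cdot> (u \<cdot> k') = Zer C K' A"
    using Comp_assoc[OF k' u e] eu kernel_Comp[OF ker' k' e'] by simp
  then obtain t where t: "t \<in> homset C K' K" and kt: "k \<cdot> t = u \<cdot> k'"
    using kernel_factor[OF ker k e Comp_closed[OF k' u]] by blast
  \<comment> \<open>The kernel of \<open>v\<close> is \<open>m = (- t, k')\<close>, with \<open>n'\<close> being \<open>- t\<close>.\<close>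
  obtain n' where n: "n' \<in> homset C K' K" "t \<uplus> n' = Zer C K' K" "n' \<uplus> t = Zer C K' K"
    using ex_neg[OF t] .
  define m where "m = (i \<cdot> n') \<uplus> (j \<cdot> k')"
  note ma = Comp_closed[OF n(1) i] and mb = Comp_closed[OF k' j]
  have m: "m \<in> homset C K' S" unfolding m_def using Add_closed[OF ma mb] .
  have pm: "p \<cdot> m = n'"
    unfolding m_def
    using Comp_Add[OF ma mb p] Comp_assoc[OF n(1) i p] Comp_assoc[OF k' j p] eqs Id_Comp[OF n(1)]
      Zer_Comp[OF k' o(1)] Add_Zer[OF n(1)] by simp
  have qm: "q \<cdot> m = k'"
    unfolding m_def
    using Comp_Add[OF ma mb q] Comp_assoc[OF n(1) i q] Comp_assoc[OF k' j q] eqs Id_Comp[OF k']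
      Zer_Comp[OF n(1) o(2)] Add_Zer[OF k'] by simp
  have vm: "v \<cdot> m = Zer C K' P"
    using vx[OF m] pm qm kt Comp_Add[OF n(1) t k] n Comp_Zer[OF k o(3)] by simp
  have km: "is_kernel C m v"
  proof (rule kernelI[OF m v vm])
    show "is_mono C m" using mono_Comp_left[OF m q] qm kernel_mono[OF ker'] by simp
    fix X x assume x: "x \<in> homset C X S" and 0: "v \<cdot> x = Zer C X P"
    have X: "X \<in> Obj C" using hom_Obj[OF x] by blast
    note px = Comp_closed[OF x p] and qx = Comp_closed[OF x q]
    note kpx = Comp_closed[OF px k] and uqx = Comp_closed[OF qx u]
    \<comment> \<open>The second component \<open>q \<cdot> x\<close> lies in the kernel \<open>K'\<close> of \<open>e'\<close>; it determines the first one,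
      since \<open>k\<close> is mono.\<close>
    have "e \<cdot> (k \<cdot> (p \<cdot> x)) = Zer C X A"
      using Comp_assoc[OF px k e] kernel_Comp[OF ker k e] Zer_Comp[OF px] hom_Obj[OF e] by simp
    moreover have "e \<cdot> (u \<cdot> (q \<cdot> x)) = e' \<cdot> (q \<cdot> x)" using Comp_assoc[OF qx u e] eu by simp
    ultimately have "e' \<cdot> (q \<cdot> x) = e \<cdot> (v \<cdot> x)"
      using vx[OF x] Comp_Add[OF kpx uqx e] Add_Zer[OF Comp_closed[OF qx e']] by simp
    then have "e' \<cdot> (q \<cdot> x) = Zer C X A" using 0 Comp_Zer[OF e X] by simp
    then obtain y where y: "y \<in> homset C X K'" and ky: "k' \<cdot> y = q \<cdot> x"
      using kernel_factor[OF ker' k' e' qx] by blast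
    note my = Comp_closed[OF y m]
    have pmy: "p \<cdot> (m \<cdot> y) = n' \<cdot> y" using Comp_assoc[OF y m p] pm by simp
    have qmy: "q \<cdot> (m \<cdot> y) = q \<cdot> x" using Comp_assoc[OF y m q] qm ky by simp
    note ny = Comp_closed[OF y n(1)]
    have "v \<cdot> (m \<cdot> y) = v \<cdot> x"
      using Comp_assoc[OF y m v] vm Zer_Comp[OF y] hom_Obj[OF v] 0 by simp
    then have "(k \<cdot> (n' \<cdot> y)) \<uplus> (u \<cdot> (q \<cdot> x)) = (k \<cdot> (p \<cdot> x)) \<uplus> (u \<cdot> (q \<cdot> x))"
      using vx[OF my] vx[OF x] pmy qmy by simp
    then have "(u \<cdot> (q \<cdot> x)) \<uplus> (k \<cdot> (n' \<cdot> y)) = (u \<cdot> (q \<cdot> x)) \<uplus> (k \<cdot> (p \<cdot> x))"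
      using Add_commute[OF uqx kpx] Add_commute[OF uqx Comp_closed[OF ny k]] by simp
    then have "k \<cdot> (n' \<cdot> y) = k \<cdot> (p \<cdot> x)"
      using Add_left_cancel[OF uqx Comp_closed[OF ny k] kpx] by blast
    then have "n' \<cdot> y = p \<cdot> x" using mono_cancel[OF kernel_mono[OF ker] k ny px] by blast
    then have "m \<cdot> y = x"
      using biproduct_decompose[OF b x] biproduct_decompose[OF b my] pmy qmy by simp
    then show "\<exists>h \<in> homset C X K'. m \<cdot> h = x" using y by blast
  qed
  have "is_epi C v"
  proof (rule epiI[OF v])
    fix X w assume w: "w \<in> homset C P X" and 0: "w \<cdot> v = Zer C S X"
    have X: "X \<in> Obj C" using hom_Obj[OF w] by blast
    have "w \<cdot> k = Zer C K X" using vi Comp_assoc[OF i v w] 0 Zer_Comp[OF i X] by simp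
    then obtain w' where w': "w' \<in> homset C A X" "w' \<cdot> e = w"
      using cokernel_factor[OF cokernel_of_kernel[OF epi e ker k] k e w] by blast
    have "w \<cdot> u = Zer C P' X" using vj Comp_assoc[OF j v w] 0 Zer_Comp[OF j X] by simp
    then have "w' \<cdot> e' = Zer C P' X" using w' eu Comp_assoc[OF u e w'(1)] by simp
    then have "w' = Zer C A X" using epi_cancel_Zer[OF epi' e' w'(1)] by blast
    then show "w = Zer C P X" using w' Zer_Comp[OF e X] by simp
  qed
  then have "ses C m v" using km unfolding ses_def by blast
  then have "pdim_le C n S" using pdim_le_of_ses_left[OF _ m v P K'] by blast
  then show ?thesis using pdim_le_of_ses_middle[OF biproduct_ses[OF b] i q P'] by blast
qed

end

section \<open>Resolutions and dimension\<close>

context abelian_category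
begin

lemma resolution_of_projective:
  assumes A: "projective C A"
  shows "\<exists>X d. projective_resolution C A 0 X d"
proof -
  obtain Z where Z: "zero_object C Z" using ex_zero_object by blast
  have o: "A \<in> Obj C" "Z \<in> Obj C" using projective_Obj[OF A] zero_object_Obj[OF Z] .
  define X where "X i = (if i = 0 \<or> i = 3 then Z else A)" for i :: nat
  define d where "d i = (if i = 0 then Zer C A Z else if i = 1 then Id C A else Zer C Z A)" for i :: nat
  have "d i \<in> homset C (X (i + 1)) (X i)" if "i < 3" for i
    using that o Zer_closed Id_closed unfolding X_def d_def by (auto simp: less_Suc_eq numeral_3_eq_3)
  moreover have "exact_at C (d (i + 1)) (d i)" if "i < 2" for i
  proof -
    have "exact_at C (Id C A) (Zer C A Z)"
      using exact_zero_right[OF Z Id_closed[OF o(1)]] Id_epi[OF o(1)] by blast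
    moreover have "exact_at C (Zer C Z A) (Id C A)"
      using exact_zero_left[OF Z Id_closed[OF o(1)]] Id_mono[OF o(1)] by blast
    ultimately show ?thesis using that unfolding d_def by (auto simp: less_Suc_eq numeral_2_eq_2)
  qed
  ultimately have "projective_resolution C A 0 X d"
    unfolding projective_resolution_def using Z A by (auto simp: X_def)
  then show ?thesis by blast
qed

text \<open>
  Exactness of \<open>0 \<rightarrow> P \<rightarrow> A \<rightarrow> 0\<close> makes the augmentation mono and epi.  Being the cokernel of its zero
  kernel, it has a left inverse, which is then two-sided.
\<close>
lemma projective_of_resolution:
  assumes "projective_resolution C A 0 X d"
  shows "projective C A"
proof -
  have Z: "zero_object C (X 0)" "zero_object C (X 3)" and P: "projective C (X 2)" and A: "X 1 = A"
    and d: "\<And>i. i < 3 \<Longrightarrow> d i \<in> homset C (X (i + 1)) (X i)"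
    and ex: "\<And>i. i < 2 \<Longrightarrow> exact_at C (d (i + 1)) (d i)"
    using assms unfolding projective_resolution_def by (auto simp: numeral_2_eq_2)
  have d0: "d 0 \<in> homset C A (X 0)" and d1: "d 1 \<in> homset C (X 2) A"
    and d2: "d 2 \<in> homset C (X 3) (X 2)"
    using d[of 0] d[of 1] d[of 2] A by (simp_all add: numeral_2_eq_2 numeral_3_eq_3)
  have e: "is_epi C (d 1)"
    using ex[of 0] hom_to_zero[OF Z(1) d0] exact_zero_right[OF Z(1) d1] by simp
  have "is_mono C (d 1)"
    using ex[of 1] hom_from_zero[OF Z(2) d2] exact_zero_left[OF Z(2) d1]
    by (simp add: numeral_2_eq_2)
  note k = zero_mono_kernel[OF Z(2) d1 this]
  have o: "X 2 \<in> Obj C" "X 3 \<in> Obj C" "A \<in> Obj C" using hom_Obj d1 d2 by blast+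
  note z = Zer_closed[OF o(2,1)]
  obtain s where s: "s \<in> homset C A (X 2)" "s \<cdot> d 1 = Id C (X 2)"
    using cokernel_factor[OF cokernel_of_kernel[OF e d1 k z] z d1 Id_closed[OF o(1)] Id_Comp[OF z]] .
  have "(d 1 \<cdot> s) \<cdot> d 1 = Id C A \<cdot> d 1"
    using Comp_assoc[OF d1 s(1) d1] s Comp_Id[OF d1] Id_Comp[OF d1] by simp
  then have "d 1 \<cdot> s = Id C A"
    using epi_cancel[OF e d1 Comp_closed[OF s(1) d1] Id_closed[OF o(3)]] by blast
  then show ?thesis using retract_projective[OF P d1 s(1)] by blast
qed

lemma exact_at_mono_right:
  assumes "f \<in> homset C A B" "m \<in> homset C B X" "is_mono C m"
  shows "exact_at C g (m \<cdot> f) \<longleftrightarrow> exact_at C g f"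
  using kernel_cong_mono[OF assms] unfolding exact_at_def by simp

text \<open>
  With \<open>X 0 = 0\<close> and \<open>X 1 = K\<close>, the object \<open>K\<close> is replaced by the two entries \<open>A\<close>, \<open>P\<close>, so the
  entries from \<open>X 2\<close> on move up by one.  The new differential into \<open>P\<close> is the augmentation
  of \<open>K\<close> followed by the inclusion \<open>k\<close>.
\<close>
lemma resolution_splice:
  assumes ses: "ses C k e" and k: "k \<in> homset C K P" and e: "e \<in> homset C P A"
    and P: "projective C P" and res: "projective_resolution C K n X d"
  shows "\<exists>X d. projective_resolution C A (Suc n) X d"
proof -
  have ker: "is_kernel C k e" and epi: "is_epi C e" using ses unfolding ses_def by auto
  have Z: "zero_object C (X 0)" "zero_object C (X (n + 3))"
    and PX: "\<And>i. i \<le> n \<Longrightarrow> projective C (X (i + 2))" and K: "X 1 = K"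
    and d: "\<And>i. i < n + 3 \<Longrightarrow> d i \<in> homset C (X (i + 1)) (X i)"
    and ex: "\<And>i. i < n + 2 \<Longrightarrow> exact_at C (d (i + 1)) (d i)"
    using res unfolding projective_resolution_def by auto
  have d0: "d 0 \<in> homset C K (X 0)" and d1: "d 1 \<in> homset C (X 2) K"
    and d2: "d 2 \<in> homset C (X 3) (X 2)"
    using d[of 0] d[of 1] d[of 2] K by (simp_all add: numeral_2_eq_2 numeral_3_eq_3)
  have o: "A \<in> Obj C" "X 0 \<in> Obj C" using hom_Obj e d0 by blast+
  have d1e: "is_epi C (d 1)"
    using ex[of 0] hom_to_zero[OF Z(1) d0] exact_zero_right[OF Z(1) d1] by simp
  define X' where "X' i = (case i of 0 \<Rightarrow> X 0 | Suc 0 \<Rightarrow> A | Suc (Suc 0) \<Rightarrow> P | Suc j \<Rightarrow> X j)" for i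
  define d' where "d' i = (case i of 0 \<Rightarrow> Zer C A (X 0) | Suc 0 \<Rightarrow> e | Suc (Suc 0) \<Rightarrow> k \<cdot> d 1
    | Suc j \<Rightarrow> d j)" for i
  have d': "d' 0 = Zer C A (X 0)" "d' (Suc 0) = e" "d' (Suc (Suc 0)) = k \<cdot> d 1"
    "\<And>j. d' (Suc (Suc (Suc j))) = d (Suc (Suc j))" by (simp_all add: d'_def)
  have X': "X' 0 = X 0" "X' (Suc 0) = A" "X' (Suc (Suc 0)) = P"
    "\<And>j. X' (Suc (Suc (Suc j))) = X (Suc (Suc j))" by (simp_all add: X'_def)
  have "d' i \<in> homset C (X' (i + 1)) (X' i)" if i: "i < Suc n + 3" for i
  proof -
    consider "i = 0" | "i = Suc 0" | "i = Suc (Suc 0)" | j where "i = Suc (Suc (Suc j))"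
      by (metis not0_implies_Suc)
    then show ?thesis
    proof cases
      case 1 then show ?thesis using Zer_closed[OF o] by (simp add: d' X')
    next
      case 2 then show ?thesis using e by (simp add: d' X')
    next
      case 3 then show ?thesis using Comp_closed[OF d1 k] by (simp add: d' X' numeral_2_eq_2)
    next
      case (4 j) then show ?thesis using d[of "Suc (Suc j)"] i by (simp add: d' X')
    qed
  qed
  moreover have "exact_at C (d' (i + 1)) (d' i)" if i: "i < Suc n + 2" for i
  proof -
    consider "i = 0" | "i = Suc 0" | "i = Suc (Suc 0)" | j where "i = Suc (Suc (Suc j))"
      by (metis not0_implies_Suc)
    then show ?thesis
    proof cases
      case 1 then show ?thesis using exact_zero_right[OF Z(1) e] epi by (simp add: d')
    next
      case 2 then show ?thesis using exact_atI[OF ker k d1e d1] by (simp add: d')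
    next
      case 3 then show ?thesis
        using ex[of 1] exact_at_mono_right[OF d1 k kernel_mono[OF ker]] by (simp add: d' numeral_2_eq_2)
    next
      case (4 j) then show ?thesis using ex[of "Suc (Suc j)"] i by (simp add: d')
    qed
  qed
  moreover have "projective C (X' (i + 2))" if "i \<le> Suc n" for i
    using that PX[of "i - 1"] P X' by (cases i) (auto simp: numeral_2_eq_2)
  ultimately have "projective_resolution C A (Suc n) X' d'"
    unfolding projective_resolution_def using Z X' by (auto simp: numeral_3_eq_3)
  then show ?thesis by blast
qed

text \<open>
  The inverse of splicing: \<open>K\<close> is the kernel of the augmentation, and by exactness the first
  differential factors as an epimorphism onto \<open>K\<close> followed by the inclusion.
\<close>
lemma resolution_truncate:
  assumes res: "projective_resolution C A (Suc n) X d"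
  shows "\<exists>k e K X' d'. ses C k e \<and> k \<in> homset C K (X 2) \<and> e \<in> homset C (X 2) A \<and>
    projective C (X 2) \<and> projective_resolution C K n X' d'"
proof -
  have Z: "zero_object C (X 0)" "zero_object C (X (n + 4))"
    and PX: "\<And>i. i \<le> Suc n \<Longrightarrow> projective C (X (i + 2))" and A: "X 1 = A"
    and d: "\<And>i. i < n + 4 \<Longrightarrow> d i \<in> homset C (X (i + 1)) (X i)"
    and ex: "\<And>i. i < n + 3 \<Longrightarrow> exact_at C (d (i + 1)) (d i)"
    using res unfolding projective_resolution_def by (auto simp: add.commute)
  have d0: "d 0 \<in> homset C A (X 0)" and d1: "d 1 \<in> homset C (X 2) A"
    and d2: "d 2 \<in> homset C (X 3) (X 2)"
    using d[of 0] d[of 1] d[of 2] A by (simp_all add: numeral_2_eq_2 numeral_3_eq_3)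
  have d1e: "is_epi C (d 1)"
    using ex[of 0] hom_to_zero[OF Z(1) d0] exact_zero_right[OF Z(1) d1] by simp
  have ex1: "exact_at C (d 2) (d 1)" using ex[of 1] by (simp add: numeral_2_eq_2)
  obtain k K e where ker: "is_kernel C k (d 1)" and k: "k \<in> homset C K (X 2)"
    and e: "is_epi C e" "e \<in> homset C (X 3) K" and d2e: "d 2 = k \<cdot> e"
    using exact_atE[OF ex1 d2 d1] .
  have o: "K \<in> Obj C" "X 0 \<in> Obj C" using hom_Obj k d0 by blast+
  define X' where "X' i = (case i of 0 \<Rightarrow> X 0 | Suc 0 \<Rightarrow> K | Suc (Suc j) \<Rightarrow> X (Suc (Suc (Suc j))))" for i
  define d' where "d' i = (case i of 0 \<Rightarrow> Zer C K (X 0) | Suc 0 \<Rightarrow> e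
    | Suc (Suc j) \<Rightarrow> d (Suc (Suc (Suc j))))" for i
  have d': "d' 0 = Zer C K (X 0)" "d' (Suc 0) = e"
    "\<And>j. d' (Suc (Suc j)) = d (Suc (Suc (Suc j)))" by (simp_all add: d'_def)
  have X': "X' 0 = X 0" "X' (Suc 0) = K"
    "\<And>j. X' (Suc (Suc j)) = X (Suc (Suc (Suc j)))" by (simp_all add: X'_def)
  have "d' i \<in> homset C (X' (i + 1)) (X' i)" if i: "i < n + 3" for i
  proof -
    consider "i = 0" | "i = Suc 0" | j where "i = Suc (Suc j)"
      by (metis not0_implies_Suc)
    then show ?thesis
    proof cases
      case 1 then show ?thesis using Zer_closed[OF o] by (simp add: d' X')
    next
      case 2 then show ?thesis using e by (simp add: d' X' numeral_3_eq_3)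
    next
      case (3 j) then show ?thesis using d[of "Suc (Suc (Suc j))"] i by (simp add: d' X')
    qed
  qed
  moreover have "exact_at C (d' (i + 1)) (d' i)" if i: "i < n + 2" for i
  proof -
    consider "i = 0" | "i = Suc 0" | j where "i = Suc (Suc j)"
      by (metis not0_implies_Suc)
    then show ?thesis
    proof cases
      case 1 then show ?thesis using exact_zero_right[OF Z(1) e(2)] e by (simp add: d')
    next
      case 2 then show ?thesis
        using ex[of 2] exact_at_mono_right[OF e(2) k kernel_mono[OF ker]] d2e i
        by (simp add: d' numeral_2_eq_2 numeral_3_eq_3)
    next
      case (3 j) then show ?thesis using ex[of "Suc (Suc (Suc j))"] i by (simp add: d')
    qed
  qed
  moreover have "projective C (X' (i + 2))" if "i \<le> n" for i
    using that PX[of "Suc i"] X' by (simp add: numeral_2_eq_2)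
  moreover have "zero_object C (X' (n + 3))"
    using Z(2) X' by (simp add: numeral_3_eq_3 eval_nat_numeral)
  ultimately have "projective_resolution C K n X' d'"
    unfolding projective_resolution_def using Z X' by auto
  moreover have "ses C k (d 1)" using ker d1e unfolding ses_def by blast
  moreover have "projective C (X 2)" using PX[of 0] by (simp add: numeral_2_eq_2)
  ultimately show ?thesis using k d1 by blast
qed

lemma resolution_iff_pdim_le: "(\<exists>X d. projective_resolution C A n X d) \<longleftrightarrow> pdim_le C n A"
proof (induction n arbitrary: A)
  case 0
  then show ?case using resolution_of_projective projective_of_resolution by auto
next
  case (Suc n)
  show ?case
  proof
    assume "\<exists>X d. projective_resolution C A (Suc n) X d"
    then obtain X d where "projective_resolution C A (Suc n) X d" by blast
    from resolution_truncate[OF this] show "pdim_le C (Suc n) A" using Suc by auto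
  next
    assume "pdim_le C (Suc n) A"
    then obtain k e K P where "ses C k e" "k \<in> homset C K P" "e \<in> homset C P A"
      "projective C P" "pdim_le C n K" by auto
    moreover from this obtain X d where "projective_resolution C K n X d" using Suc by blast
    ultimately show "\<exists>X d. projective_resolution C A (Suc n) X d"
      using resolution_splice by blast
  qed
qed

lemma dp_eq: "dp C A = Inf (enat ` {n. pdim_le C n A})"
  unfolding dp_def resolution_iff_pdim_le ..

text \<open>
  An infimum \<open>0\<close> cannot come from the empty set, whose infimum is \<open>\<infinity>\<close>, and infima of nonempty
  sets of extended naturals are attained.
\<close>
lemma dp_eq_0_iff: "dp C A = 0 \<longleftrightarrow> projective C A"
proof
  assume 0: "dp C A = 0"
  have "enat ` {n. pdim_le C n A} \<noteq> {}"
  proof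
    assume "enat ` {n. pdim_le C n A} = {}"
    then show False using 0 unfolding dp_eq by (simp add: Inf_enat_def)
  qed
  then have "Inf (enat ` {n. pdim_le C n A}) \<in> enat ` {n. pdim_le C n A}"
    by (auto simp: Inf_enat_def intro: LeastI)
  then have "pdim_le C 0 A" using 0 unfolding dp_eq by (auto simp: zero_enat_def)
  then show "projective C A" by simp
next
  assume "projective C A"
  then have "enat 0 \<in> enat ` {n. pdim_le C n A}" by auto
  then have "Inf (enat ` {n. pdim_le C n A}) \<le> enat 0" by (rule Inf_lower)
  then show "dp C A = 0" unfolding dp_eq by (simp flip: zero_enat_def)
qed

end

section \<open>Transport along an exact functor\<close>

lemma exact_functor_ses:
  assumes "abelian_category C" "abelian_category D" "exact_functor C D F" "ses C k e"
  shows "ses D (AMap F k) (AMap F e)"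
  using assms abelian_category.short_exact_iff_ses exact_functor.AMap_short_exact by metis

lemma pdim_le_image:
  assumes C: "abelian_category C" and D: "abelian_category D" and F: "exact_functor C D F"
    and respects: "respects_projectivity C D F" and A: "pdim_le C n A"
  shows "pdim_le D n (OMap F A)"
  using A
proof (induction n arbitrary: A)
  case 0
  then show ?case using respects projective_Obj[of C A] unfolding respects_projectivity_def by auto
next
  case (Suc n)
  interpret F: exact_functor C D F by (rule F)
  obtain k e K P where s: "ses C k e" "k \<in> homset C K P" "e \<in> homset C P A"
    "projective C P" "pdim_le C n K" using Suc.prems by auto
  have "projective D (OMap F P)"
    using s(4) respects projective_Obj[of C P] unfolding respects_projectivity_def by blast
  then show ?case
    using exact_functor_ses[OF C D F s(1)] F.AMap_closed[OF s(2)] F.AMap_closed[OF s(3)]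
      Suc.IH[OF s(5)] by auto
qed

text \<open>
  The inductive step starts from an arbitrary presentation of \<open>A\<close> in \<open>C\<close>.  Its image need not be
  part of the given resolution of \<open>F A\<close>, which is why \<open>pdim_le_syzygy\<close> is needed.
\<close>
lemma pdim_le_preimage:
  assumes C: "abelian_category C" and D: "abelian_category D" and F: "exact_functor C D F"
    and enough: "enough_projectives C"
    and respects: "respects_projectivity C D F" and reflects: "reflects_projectivity C D F"
    and "A \<in> Obj C" "pdim_le D n (OMap F A)"
  shows "pdim_le C n A"
  using assms(7,8)
proof (induction n arbitrary: A)
  case 0
  then show ?case using reflects unfolding reflects_projectivity_def by simp
next
  case (Suc n)
  interpret F: exact_functor C D F by (rule F)
  interpret C: abelian_category C by (rule C)
  interpret D: abelian_category D by (rule D)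
  obtain P e where P: "projective C P" and e: "e \<in> homset C P A" and epi: "is_epi C e"
    using enough Suc.prems(1) unfolding enough_projectives_def by blast
  obtain k where ker: "is_kernel C k e" using C.ex_kernel C.hom_Arr[OF e] by blast
  note k = C.kernel_hom[OF ker e]
  have s: "ses C k e" using ker epi unfolding ses_def by blast
  have FP: "projective D (OMap F P)"
    using P respects projective_Obj[of C P] unfolding respects_projectivity_def by blast
  have "pdim_le D n (OMap F (Dom C k))"
    using D.pdim_le_syzygy[OF Suc.prems(2) exact_functor_ses[OF C D F s] F.AMap_closed[OF k]
        F.AMap_closed[OF e] FP] .
  then have "pdim_le C n (Dom C k)" using Suc.IH C.hom_Obj[OF k] by blast
  then show ?case using s k e P by auto
qed

theorem mainTheorem11:
  fixes C :: "('o, 'm) preadditive_cat"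
    and D :: "('p, 'n) preadditive_cat"
    and F :: "('o, 'm, 'p, 'n) funct"
  assumes "abelian_category C"
    and "abelian_category D"
    and "enough_projectives C"
    and "exact_functor C D F"
  shows "respects_projectivity C D F \<and> reflects_projectivity C D F \<longleftrightarrow>
    (\<forall>A \<in> Obj C. dp C A = dp D (OMap F A))"
proof
  assume "respects_projectivity C D F \<and> reflects_projectivity C D F"
  then have "pdim_le C n A \<longleftrightarrow> pdim_le D n (OMap F A)" if "A \<in> Obj C" for n A
    using pdim_le_image[OF assms(1,2,4)] pdim_le_preimage[OF assms(1,2,4,3)] that by blast
  then show "\<forall>A \<in> Obj C. dp C A = dp D (OMap F A)"
    unfolding abelian_category.dp_eq[OF assms(1)] abelian_category.dp_eq[OF assms(2)] by simp
next
  assume "\<forall>A \<in> Obj C. dp C A = dp D (OMap F A)"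
  then have "projective C A \<longleftrightarrow> projective D (OMap F A)" if "A \<in> Obj C" for A
    using that abelian_category.dp_eq_0_iff[OF assms(1), of A]
      abelian_category.dp_eq_0_iff[OF assms(2), of "OMap F A"] by simp
  then show "respects_projectivity C D F \<and> reflects_projectivity C D F"
    unfolding respects_projectivity_def reflects_projectivity_def by blast
qed

end
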